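(* We have $a_1(q,u)=u$ and, for all $d\geq 2$, $$a_d(q,u)=\frac{(q-1)\,u^d(u-1)(u-q)}{(q^d-1)(q^d-q)\cdots(q^d-q^{d-1})}\cdot\overline{a}_d(q,u),$$ where $\overline{a}_d(q,u)\in\mathbb{Q}(q)[u]$ is a polynomial in $u$ of the form $$\overline{a}_d(q,u)=\sum_{r=0}^{d-2}[r+1]_q\,u^{d^2-d-2-r}+\mbox{ terms of lower $u$-degree},$$ i.e. the remaining terms have $u$-degree strictly less than $d^2-2d$.
   Context: $[a]_q=\frac{q^a-1}{q-1}=1+q+\dots+q^{a-1}$ for $a\ge 1$. Empty products are $1$. Two-variable polynomials $a_d(q,u)$: let $\widehat{R}=\mathbb{Q}(q,u)[[t]]$ with its $t$-adic topology and $\mathfrak{m}=t\widehat{R}$. Let ${\rm Exp}:\mathfrak{m}\to 1+\mathfrak{m}$ be the plethystic exponential, the continuous isomorphism from the additive group $\mathfrak m$ to the multiplicative group $1+\mathfrak m$ with ${\rm Exp}(q^iu^nt^d)=(1-q^iu^nt^d)^{-1}$, and let ${\rm Log}$ be its inverse; explicitly, if $\log P=L(q,u,t)$, then ${\rm Log}(P)=\sum_{i\ge1}\frac{\mu(i)}{i}L(q^i,u^i,t^i)$, with $\mu$ the Moebius function. Let $T$ be the $\mathbb{Q}(q,u)$-linear continuous operator on $\widehat R$ with $T(t^d)=(-1)^d(q^{-1}u)^{-d(d-1)/2}t^d$. Then $a_d(q,u)\in\mathbb{Q}(q)[u]$ is defined by $$\sum_{d\geq 1}a_d(q,u)t^d=(1-q)\cdot{\rm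 Log}\bigl(T^{-1}\bigl(G(t)^{-1}\bigr)\bigr),\qquad G(t)=\sum_{d\geq 0}\frac{u^{d(d+1)/2}t^d}{(1-q)\cdots(1-q^d)}.$$ *)

theory Defs
  imports
    "HOL-Computational_Algebra.Computational_Algebra"
begin

section \<open>The fields \<open>\<rat>(q)\<close> and \<open>\<rat>(q,u)\<close>\<close>

text \<open>\<open>\<rat>(q,u)\<close> is realised as the fraction field of \<open>\<rat>(q)[u]\<close>, so that elements of
  \<open>\<rat>(q)[u]\<close> are honest univariate polynomials.\<close>

type_synonym Qq = "rat poly fract"
type_synonym Qqu = "rat poly fract poly fract"

definition q_base :: Qq
  where "q_base = Fract [:0, 1:] 1"

definition of_upoly :: "Qq poly \<Rightarrow> Qqu"
  where "of_upoly p = Fract p 1"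

definition q :: Qqu
  where "q = of_upoly [:q_base:]"

definition u :: Qqu
  where "u = of_upoly [:0, 1:]"

definition qint :: "nat \<Rightarrow> Qq"
  where "qint a = (q_base ^ a - 1) / (q_base - 1)"

section \<open>The substitutions \<open>q \<mapsto> q\<^sup>i\<close>, \<open>u \<mapsto> u\<^sup>i\<close>, \<open>t \<mapsto> t\<^sup>i\<close>\<close>

text \<open>The extension of an injective ring homomorphism to the fraction fields; the lemma
  \<open>fract_map_Fract\<close> shows that it is well defined.\<close>

definition fract_map :: "('a::idom \<Rightarrow> 'b::idom) \<Rightarrow> 'a fract \<Rightarrow> 'b fract"
  where "fract_map h x = (THE y. \<exists>a b. b \<noteq> 0 \<and> x = Fract a b \<and> y = Fract (h a) (h b))"

lemma fract_map_Fract: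
  assumes mult: "\<And>x y. h (x * y) = h x * h y"
    and nz: "\<And>x. h x = 0 \<longleftrightarrow> x = 0"
    and b: "b \<noteq> 0"
  shows "fract_map h (Fract a b) = Fract (h a) (h b)"
  unfolding fract_map_def
proof (rule the_equality)
  show "\<exists>a' b'. b' \<noteq> 0 \<and> Fract a b = Fract a' b' \<and> Fract (h a) (h b) = Fract (h a') (h b')"
    using b by blast
next
  fix y assume "\<exists>a' b'. b' \<noteq> 0 \<and> Fract a b = Fract a' b' \<and> y = Fract (h a') (h b')"
  then obtain a' b' where *: "b' \<noteq> 0" "Fract a b = Fract a' b'" "y = Fract (h a') (h b')"
    by blast
  have "a * b' = a' * b" using * b by (simp add: eq_fract)
  then have "h a * h b' = h a' * h b" by (metis mult)
  then show "y = Fract (h a) (h b)" using * b by (simp add: eq_fract nz)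
qed

definition subst_q :: "nat \<Rightarrow> Qq \<Rightarrow> Qq"
  where "subst_q i = fract_map (\<lambda>p. pcompose p (monom 1 i))"

definition subst_qu :: "nat \<Rightarrow> Qqu \<Rightarrow> Qqu"
  where "subst_qu i = fract_map (\<lambda>p. pcompose (map_poly (subst_q i) p) (monom 1 i))"

definition subst_qut :: "nat \<Rightarrow> Qqu fps \<Rightarrow> Qqu fps"
  where "subst_qut i F = fps_compose (Abs_fps (\<lambda>d. subst_qu i (F $ d))) (fps_X ^ i)"

lemma pcompose_monom_eq_0_iff:
  fixes p :: "'a::idom poly"
  assumes "i > 0"
  shows "pcompose p (monom 1 i) = 0 \<longleftrightarrow> p = 0"
  using assms by (simp add: pcompose_eq_0_iff degree_monom_eq)

lemma subst_q_Fract: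
  assumes "i > 0" "b \<noteq> 0"
  shows "subst_q i (Fract a b) = Fract (pcompose a (monom 1 i)) (pcompose b (monom 1 i))"
  unfolding subst_q_def
  by (rule fract_map_Fract) (use assms in \<open>auto simp: pcompose_mult pcompose_monom_eq_0_iff\<close>)

lemma subst_q_eq_0_iff: 
  assumes "i > 0"
  shows "subst_q i x = 0 \<longleftrightarrow> x = 0"
proof (cases x)
  case (Fract a b)
  then show ?thesis
    using assms by (simp add: subst_q_Fract Zero_fract_def eq_fract pcompose_monom_eq_0_iff)
qed

lemma subst_q_0: "i > 0 \<Longrightarrow> subst_q i 0 = 0"
  by (simp add: subst_q_eq_0_iff)

lemma subst_q_1: "i > 0 \<Longrightarrow> subst_q i 1 = 1"
  by (simp add: One_fract_def subst_q_Fract pcompose_1)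

lemma subst_q_add:
  assumes "i > 0"
  shows "subst_q i (x + y) = subst_q i x + subst_q i y"
  using assms
  by (cases x; cases y)
     (simp add: subst_q_Fract pcompose_add pcompose_mult pcompose_monom_eq_0_iff)

lemma subst_q_mult:
  assumes "i > 0"
  shows "subst_q i (x * y) = subst_q i x * subst_q i y"
  using assms
  by (cases x; cases y) (simp add: subst_q_Fract pcompose_mult)

lemma subst_q_sum:
  assumes "i > 0"
  shows "subst_q i (sum f A) = (\<Sum>x\<in>A. subst_q i (f x))"
  by (induction A rule: infinite_finite_induct) (auto simp: subst_q_0 subst_q_add assms)

lemma subst_q_q: "i > 0 \<Longrightarrow> subst_q i q_base = q_base ^ i"
proof -
  assume "i > 0"
  have "Fract [:0, 1::rat:] 1 ^ i = Fract ([:0, 1:] ^ i) 1"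
    by (induction i) (auto simp: One_fract_def)
  with \<open>i > 0\<close> show ?thesis
    by (simp add: q_base_def subst_q_Fract pcompose_pCons pcompose_1 monom_altdef)
qed

lemma map_poly_subst_q_mult:
  assumes "i > 0"
  shows "map_poly (subst_q i) (x * y) = map_poly (subst_q i) x * map_poly (subst_q i) y"
  by (rule poly_eqI)
     (simp add: coeff_map_poly subst_q_0 coeff_mult subst_q_sum subst_q_mult assms)

lemma map_poly_subst_q_add:
  assumes "i > 0"
  shows "map_poly (subst_q i) (x + y) = map_poly (subst_q i) x + map_poly (subst_q i) y"
  by (rule poly_eqI) (simp add: coeff_map_poly subst_q_0 subst_q_add assms)

lemma map_poly_subst_q_eq_0_iff:
  assumes "i > 0"
  shows "map_poly (subst_q i) x = 0 \<longleftrightarrow> x = 0"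
  by (simp add: poly_eq_iff coeff_map_poly subst_q_0 subst_q_eq_0_iff assms)

lemma subst_qu_Fract:
  assumes "i > 0" "b \<noteq> 0"
  shows "subst_qu i (Fract a b) =
    Fract (pcompose (map_poly (subst_q i) a) (monom 1 i))
          (pcompose (map_poly (subst_q i) b) (monom 1 i))"
  unfolding subst_qu_def
  by (rule fract_map_Fract)
     (use assms in \<open>auto simp: pcompose_mult map_poly_subst_q_mult map_poly_subst_q_eq_0_iff
       pcompose_monom_eq_0_iff\<close>)

lemma subst_qu_1: "i > 0 \<Longrightarrow> subst_qu i 1 = 1"
  by (simp add: One_fract_def[where 'a = "Qq poly"] subst_qu_Fract subst_q_1 pcompose_1)

lemma subst_qu_0: "i > 0 \<Longrightarrow> subst_qu i 0 = 0"
  by (simp add: Zero_fract_def[where 'a = "Qq poly"] subst_qu_Fract subst_q_1 pcompose_1)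

lemma subst_qu_add:
  assumes "i > 0"
  shows "subst_qu i (x + y) = subst_qu i x + subst_qu i y"
  using assms
  by (cases x; cases y)
     (simp add: subst_qu_Fract pcompose_add pcompose_mult map_poly_subst_q_mult
       map_poly_subst_q_add pcompose_monom_eq_0_iff map_poly_subst_q_eq_0_iff)

lemma subst_qu_mult:
  assumes "i > 0"
  shows "subst_qu i (x * y) = subst_qu i x * subst_qu i y"
  using assms
  by (cases x; cases y) (simp add: subst_qu_Fract pcompose_mult map_poly_subst_q_mult)

lemma of_upoly_power: "of_upoly p ^ n = of_upoly (p ^ n)"
  by (induction n) (auto simp: of_upoly_def One_fract_def)

lemma subst_qu_q: "i > 0 \<Longrightarrow> subst_qu i q = q ^ i"
  by (simp add: q_def of_upoly_power)
     (simp add: of_upoly_def subst_qu_Fract subst_q_1 pcompose_1 map_poly_pCons subst_q_0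
       subst_q_q poly_const_pow)

lemma subst_qu_u: "i > 0 \<Longrightarrow> subst_qu i u = u ^ i"
  by (simp add: u_def of_upoly_power)
     (simp add: of_upoly_def subst_qu_Fract subst_q_1 pcompose_1 map_poly_pCons subst_q_0
       pcompose_pCons monom_altdef)

section \<open>The plethystic logarithm\<close>

definition moebius_mu :: "nat \<Rightarrow> int"
  where "moebius_mu n = (if squarefree n then (- 1) ^ card (prime_factors n) else 0)"

text \<open>For \<open>P\<close> with constant term \<open>1\<close>, \<open>fps_ln 1 oo (P - 1)\<close> is \<open>log P\<close>. The series over \<open>i\<close>
  (shifted by one, since \<open>suminf\<close> starts at \<open>0\<close>) is taken in the \<open>t\<close>-adic topology, which is the
  library's topology on \<open>fps\<close>.\<close>

definition pleth_Log :: "Qqu fps \<Rightarrow> Qqu fps"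
  where "pleth_Log P =
    (\<Sum>i. fps_const (of_int (moebius_mu (Suc i)) / of_nat (Suc i))
           * subst_qut (Suc i) (fps_ln 1 oo (P - 1)))"

lemma subst_qut_nth_eq_0:
  assumes "F $ 0 = 0" "n < i"
  shows "subst_qut i F $ n = 0"
proof -
  have "subst_qu i (F $ k) * (fps_X ^ i) ^ k $ n = 0" if "k \<le> n" for k
  proof (cases "k = 0")
    case True
    then show ?thesis using assms by (simp add: subst_qu_0)
  next
    case False
    then have "i * 1 \<le> i * k" by (intro mult_le_mono) auto
    then have "n \<noteq> i * k" using assms by linarith
    then have "fps_X ^ (i * k) $ n = (0 :: Qqu)" by (simp add: fps_X_power_nth)
    then show ?thesis by (simp only: power_mult mult_zero_right)
  qed
  then show ?thesis unfolding subst_qut_def fps_compose_nth fps_nth_Abs_fps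
    by (intro sum.neutral ballI) simp_all
qed

lemma pleth_Log_sums:
  "(\<lambda>i. fps_const (of_int (moebius_mu (Suc i)) / of_nat (Suc i))
          * subst_qut (Suc i) (fps_ln 1 oo (P - 1))) sums pleth_Log P"
proof -
  let ?f = "\<lambda>i. fps_const (of_int (moebius_mu (Suc i)) / of_nat (Suc i))
          * subst_qut (Suc i) (fps_ln 1 oo (P - 1))"
  have z: "?f i $ n = 0" if "n \<le> i" for i n
    using that by (simp add: subst_qut_nth_eq_0)
  have "?f sums Abs_fps (\<lambda>n. \<Sum>i<n. ?f i $ n)"
    unfolding sums_def
  proof (rule tendsto_fpsI)
    fix n
    show "\<forall>\<^sub>F m in sequentially. (\<Sum>i<m. ?f i) $ n = Abs_fps (\<lambda>n. \<Sum>i<n. ?f i $ n) $ n"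
      using eventually_ge_at_top[of n]
    proof eventually_elim
      case (elim m)
      have "(\<Sum>i<m. ?f i $ n) = (\<Sum>i<n. ?f i $ n)"
        by (rule sum.mono_neutral_right) (use elim z in auto)
      then show ?case by (simp add: fps_sum_nth)
    qed
  qed
  then show ?thesis
    unfolding pleth_Log_def by (rule summable_sums[OF sums_summable])
qed

section \<open>The polynomials \<open>a\<^sub>d(q,u)\<close>\<close>

definition T_op :: "Qqu fps \<Rightarrow> Qqu fps"
  where "T_op F = Abs_fps (\<lambda>d. (- 1) ^ d * inverse ((inverse q * u) ^ (d * (d - 1) div 2)) * F $ d)"

lemma q_base_nonzero: "q_base \<noteq> 0"
  by (simp add: q_base_def Zero_fract_def eq_fract)

lemma q_nonzero: "q \<noteq> 0" and u_nonzero: "u \<noteq> 0"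
  by (simp_all add: q_def u_def of_upoly_def q_base_nonzero eq_fract
        Zero_fract_def[where 'a = "Qq poly"])

lemma bij_T_op: "bij T_op"
proof (rule bij_betw_byWitness)
  let ?S = "\<lambda>F. Abs_fps (\<lambda>d. (- 1) ^ d * (inverse q * u) ^ (d * (d - 1) div 2) * F $ d)"
  have [simp]: "(- 1) ^ d * ((- 1) ^ d * x) = x" for d and x :: Qqu
    by (simp flip: mult.assoc power_mult_distrib)
  show "\<forall>F\<in>UNIV. ?S (T_op F) = F" "\<forall>F\<in>UNIV. T_op (?S F) = F"
    using q_nonzero u_nonzero by (auto simp: T_op_def fps_eq_iff mult_ac)
qed auto

definition G_ser :: "Qqu fps"
  where "G_ser = Abs_fps (\<lambda>d. u ^ (d * (d + 1) div 2) / (\<Prod>i=1..d. 1 - q ^ i))"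

text \<open>The coefficients are taken in \<open>\<rat>(q,u)\<close>; that they lie in \<open>\<rat>(q)[u]\<close> is not
  built into the definition.\<close>

definition a_pol :: "nat \<Rightarrow> Qqu"
  where "a_pol d = (fps_const (1 - q) * pleth_Log (inv T_op (inverse G_ser))) $ d"

end

theory Submission
  imports Defs
begin

text \<open>Put \<open>F = T\<^sup>-\<^sup>1(G\<^sup>-\<^sup>1)\<close>, so that \<open>a\<^sub>d\<close> is \<open>1 - q\<close> times the coefficient of \<open>t\<^sup>d\<close> in \<open>Log F\<close>. The coefficients of
  \<open>F\<close>, hence of \<open>log F\<close>, are polynomials in \<open>u\<close> over \<open>\<rat>(q)\<close>, and \<open>Log\<close> combines them by the substitutions
  \<open>q \<mapsto> q\<^sup>i\<close>, \<open>u \<mapsto> u\<^sup>i\<close>. Three facts about the polynomial \<open>a\<^sub>d\<close> give the theorem.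

  \<^item> It is divisible by \<open>u\<^sup>d\<close>. Polynomials divisible by \<open>u\<^sup>n\<close> in degree \<open>n\<close> of \<open>t\<close> form a graded ring that
    is stable under all operations involved, and \<open>G\<close> has its coefficients there.

  \<^item> It vanishes at \<open>u = 1\<close> and \<open>u = q\<close> for \<open>d \<ge> 2\<close>. At these values the product formulas of Euler show
    that \<open>F\<close> becomes \<open>1 / (ct; q)\<^sub>\<infinity>\<close> for \<open>c\<close> the value of \<open>u\<close>, whose plethystic logarithm is \<open>ct / (1 - q)\<close>, with no
    terms of higher degree. The specialisations are expressed as congruences modulo \<open>u - c\<close>
    (\<open>a_pol_in_multiples\<close>).

  \<^item> Its top part is a single monomial: after multiplication by \<open>|GL\<^sub>d| / (q - 1)\<close> it is \<open>u\<close> to the power \<open>d\<^sup>2\<close>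
    plus terms of degree at most \<open>d\<^sup>2 - d + 1\<close> (\<open>a_pol_approx\<close>). For the degree of a product of
    coefficients of index \<open>i\<close> and \<open>j\<close> drops by at least \<open>i + j - 1\<close>, so inverting \<open>G\<close> and taking the logarithm
    affect the leading terms linearly.

  The first two facts produce a quotient of \<open>|GL\<^sub>d| a\<^sub>d / (q - 1)\<close> by \<open>u\<^sup>d (u - 1) (u - q)\<close>. By the third, its
  top coefficients are those of the expansion of \<open>1 / ((u - 1) (u - q))\<close> in powers of \<open>1/u\<close>, namely the
  \<open>q\<close>-integers.\<close>

section \<open>Logarithms of formal power series\<close>

text \<open>For \<open>F\<close> with constant term \<open>1\<close> this is \<open>log F\<close>, in the form in which it enters \<^const>\<open>pleth_Log\<close>.\<close>

definition fps_log :: "'a::field_char_0 fps \<Rightarrow> 'a fps"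
  where "fps_log F = fps_ln 1 oo (F - 1)"

lemma fps_log_nth_0 [simp]: "fps_log F $ 0 = 0"
  by (simp add: fps_log_def)

lemma fps_deriv_log:
  fixes F :: "'a::field_char_0 fps"
  assumes "F $ 0 = 1"
  shows "fps_deriv (fps_log F) * F = fps_deriv F"
proof -
  have 0: "(F - 1) $ 0 = 0" using assms by simp
  have "inverse (1 + fps_X) oo (F - 1) = inverse ((1 + fps_X) oo (F - 1))"
    by (rule fps_inverse_compose[OF 0]) simp
  also have "(1 + fps_X) oo (F - 1) = F"
    using 0 by (simp add: fps_compose_add_distrib)
  finally have "inverse (1 + fps_X) oo (F - 1) = inverse F" .
  then have "fps_deriv (fps_log F) = inverse F * fps_deriv F"
    by (simp add: fps_log_def fps_compose_deriv[OF 0] fps_ln_deriv)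
  moreover have "inverse F * F = 1" using assms by (simp add: inverse_mult_eq_1)
  ultimately show ?thesis by (simp add: mult_ac)
qed

text \<open>In characteristic \<open>0\<close> a series is determined by its derivative and its constant term, so the
  logarithm is pinned down by the equation \<open>L' F = F'\<close>; identities between logarithms reduce to
  the product rule.\<close>

lemma fps_log_unique:
  fixes F L :: "'a::field_char_0 fps"
  assumes F: "F $ 0 = 1" and L: "L $ 0 = 0" and ode: "fps_deriv L * F = fps_deriv F"
  shows "fps_log F = L"
proof -
  have "F \<noteq> 0" using F by auto
  moreover have "fps_deriv (fps_log F) * F = fps_deriv L * F"
    using fps_deriv_log[OF F] ode by simp
  ultimately have "fps_deriv (fps_log F) = fps_deriv L" by simp
  then show ?thesis by (simp add: fps_deriv_eq_iff L)
qed

lemma fps_log_mult: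
  fixes F E :: "'a::field_char_0 fps"
  assumes "F $ 0 = 1" "E $ 0 = 1"
  shows "fps_log (F * E) = fps_log F + fps_log E"
proof (rule fps_log_unique)
  have "fps_deriv (fps_log F + fps_log E) * (F * E)
      = (fps_deriv (fps_log F) * F) * E + F * (fps_deriv (fps_log E) * E)"
    by (simp add: algebra_simps)
  also have "\<dots> = fps_deriv (F * E)"
    unfolding fps_deriv_log[OF assms(1)] fps_deriv_log[OF assms(2)] by simp
  finally show "fps_deriv (fps_log F + fps_log E) * (F * E) = fps_deriv (F * E)" .
qed (use assms in auto)

lemma fps_log_compose_linear:
  fixes F :: "'a::field_char_0 fps"
  assumes "F $ 0 = 1"
  shows "fps_log (F oo (fps_const c * fps_X)) = fps_log F oo (fps_const c * fps_X)"
proof -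
  let ?s = "fps_const c * fps_X"
  have "(F - 1) oo ?s = (F oo ?s) - 1"
    by (simp add: fps_compose_sub_distrib)
  moreover have "fps_ln 1 oo ((F - 1) oo ?s) = fps_ln 1 oo (F - 1) oo ?s"
    using assms by (intro fps_compose_assoc) auto
  ultimately show ?thesis by (simp add: fps_log_def)
qed

lemma fps_log_one_minus_X_nth:
  "fps_log (1 - fps_X :: 'a::field_char_0 fps) $ n = - 1 / of_nat n"
  by (cases n) (simp_all add: fps_log_def fps_compose_uminus' fps_ln_nth)

section \<open>Inverses and logarithms to first order\<close>

text \<open>Rational coefficients suffice below: the recursions for the inverse and the logarithm of a
  series divide only by natural numbers.\<close>

definition rat_subspace :: "'a::field_char_0 set \<Rightarrow> bool"
  where "rat_subspace V \<longleftrightarrow>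
    0 \<in> V \<and> (\<forall>x\<in>V. \<forall>y\<in>V. x + y \<in> V) \<and> (\<forall>r. \<forall>x\<in>V. of_rat r * x \<in> V)"

lemma
  assumes "rat_subspace V"
  shows rat_subspace_0: "0 \<in> V"
    and rat_subspace_add: "x \<in> V \<Longrightarrow> y \<in> V \<Longrightarrow> x + y \<in> V"
    and rat_subspace_scale: "x \<in> V \<Longrightarrow> of_rat r * x \<in> V"
  using assms by (auto simp: rat_subspace_def)

lemma rat_subspace_uminus: "rat_subspace V \<Longrightarrow> x \<in> V \<Longrightarrow> - x \<in> V"
  using rat_subspace_scale[of V x "-1"] by simp

lemma rat_subspace_diff: "rat_subspace V \<Longrightarrow> x \<in> V \<Longrightarrow> y \<in> V \<Longrightarrow> x - y \<in> V"
  using rat_subspace_add[of V x "- y"] rat_subspace_uminus[of V y] by simp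

lemma rat_subspace_sum:
  "rat_subspace V \<Longrightarrow> (\<And>i. i \<in> A \<Longrightarrow> f i \<in> V) \<Longrightarrow> sum f A \<in> V"
  by (induction A rule: infinite_finite_induct) (auto simp: rat_subspace_0 rat_subspace_add)

lemma rat_subspace_of_nat_mult: "rat_subspace V \<Longrightarrow> x \<in> V \<Longrightarrow> of_nat n * x \<in> V"
  using rat_subspace_scale[of V x "of_nat n"] by simp

lemma rat_subspace_of_nat_multD:
  assumes "rat_subspace V" "of_nat n * x \<in> V" "n > 0"
  shows "x \<in> V"
  using rat_subspace_scale[OF assms(1,2), of "inverse (of_nat n)"] assms(3)
  by (simp add: of_rat_inverse flip: mult.assoc)

text \<open>\<open>M n\<close> bounds the coefficient of \<open>t\<^sup>n\<close>, and \<open>N n\<close> collects the smaller terms that are to be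
  neglected against it: every product of two coefficients of positive index is negligible.\<close>

definition filtration_pair :: "(nat \<Rightarrow> 'a::field_char_0 set) \<Rightarrow> (nat \<Rightarrow> 'a set) \<Rightarrow> bool"
  where "filtration_pair M N \<longleftrightarrow>
    (\<forall>n. rat_subspace (M n) \<and> rat_subspace (N n) \<and> N n \<subseteq> M n) \<and>
    (\<forall>i>0. \<forall>j>0. \<forall>x\<in>M i. \<forall>y\<in>M j. x * y \<in> N (i + j))"

lemma filtration_pairD:
  assumes "filtration_pair M N"
  shows "rat_subspace (M n)" "rat_subspace (N n)" "x \<in> N n \<Longrightarrow> x \<in> M n"
    "i > 0 \<Longrightarrow> j > 0 \<Longrightarrow> x \<in> M i \<Longrightarrow> y \<in> M j \<Longrightarrow> x * y \<in> N (i + j)"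
  using assms by (auto simp: filtration_pair_def)

lemma sum_split_ends:
  fixes f :: "nat \<Rightarrow> 'a::comm_monoid_add"
  assumes "n > 0"
  shows "(\<Sum>i=0..n. f i) = f 0 + (\<Sum>i\<in>{0<..<n}. f i) + f n"
proof -
  have "{0..n} = insert 0 (insert n {0<..<n})" using assms by auto
  then show ?thesis using assms by (simp add: add_ac)
qed

text \<open>To first order \<open>1 / F\<close> is \<open>1 - (F - 1)\<close>: in \<open>F \<cdot> (1 / F) = 1\<close> the coefficient of \<open>t\<^sup>n\<close> consists of the two
  extreme terms and of products of two coefficients of positive index.\<close>

lemma fps_inverse_nth_perturb:
  fixes F :: "'a::field_char_0 fps"
  assumes fp: "filtration_pair M N" and F0: "F $ 0 = 1"
    and FM: "\<And>n. n > 0 \<Longrightarrow> F $ n \<in> M n" and "n > 0"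
  shows "inverse F $ n + F $ n \<in> N n"
  using \<open>n > 0\<close>
proof (induction n rule: less_induct)
  case (less n)
  note D = filtration_pairD[OF fp]
  let ?S = "\<Sum>i\<in>{0<..<n}. F $ i * inverse F $ (n - i)"
  have "inverse F $ k \<in> M k" if "0 < k" "k < n" for k
    using rat_subspace_diff[OF D(1) D(3)[OF less.IH[OF that(2,1)]] FM[OF that(1)]] by simp
  then have "F $ i * inverse F $ (n - i) \<in> N (i + (n - i))" if "i \<in> {0<..<n}" for i
    using that by (intro D(4) FM) auto
  then have S: "?S \<in> N n"
    by (intro rat_subspace_sum[OF D(2)]) simp
  have "(F * inverse F) $ n = 0"
    using F0 less.prems by (simp add: inverse_mult_eq_1')
  then have "inverse F $ n + F $ n = - ?S"
    using less.prems F0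
    by (simp add: fps_mult_nth sum_split_ends eq_neg_iff_add_eq_0 add_ac)
  then show ?case using rat_subspace_uminus[OF D(2) S] by simp
qed

text \<open>To first order \<open>log F\<close> is \<open>F - 1\<close>: compare coefficients in \<open>t L' F = t F'\<close>, where all terms except
  \<open>n L\<^sub>n\<close> and \<open>n F\<^sub>n\<close> are products of two coefficients of positive index.\<close>

lemma fps_log_nth_perturb:
  fixes F :: "'a::field_char_0 fps"
  assumes fp: "filtration_pair M N" and F0: "F $ 0 = 1"
    and FM: "\<And>n. n > 0 \<Longrightarrow> F $ n \<in> M n" and "n > 0"
  shows "fps_log F $ n - F $ n \<in> N n"
  using \<open>n > 0\<close>
proof (induction n rule: less_induct)
  case (less n)
  note D = filtration_pairD[OF fp]
  define L where "L = fps_log F"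
  let ?S = "\<Sum>i\<in>{0<..<n}. of_nat i * L $ i * F $ (n - i)"
  have "L $ k \<in> M k" if "0 < k" "k < n" for k
    using rat_subspace_add[OF D(1) D(3)[OF less.IH[OF that(2,1)]] FM[OF that(1)]]
    by (simp add: L_def)
  then have "(of_nat i * L $ i) * F $ (n - i) \<in> N (i + (n - i))" if "i \<in> {0<..<n}" for i
    using that by (intro D(4) FM rat_subspace_of_nat_mult[OF D(1)]) auto
  then have S: "?S \<in> N n"
    by (intro rat_subspace_sum[OF D(2)]) simp
  have X: "(fps_X * fps_deriv H) $ k = of_nat k * H $ k" for H :: "'a fps" and k
    by (cases k) auto
  have "?S + of_nat n * L $ n = (\<Sum>i=0..n. (fps_X * fps_deriv L) $ i * F $ (n - i))"
    unfolding X using less.prems F0 by (simp add: sum_split_ends)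
  also have "\<dots> = (fps_X * (fps_deriv L * F)) $ n"
    unfolding mult.assoc[symmetric] by (rule fps_mult_nth[symmetric])
  also have "\<dots> = of_nat n * F $ n"
    unfolding L_def fps_deriv_log[OF F0] by (rule X)
  finally have "?S + of_nat n * L $ n = of_nat n * F $ n" .
  then have "of_nat n * (L $ n - F $ n) = - ?S"
    by (simp add: algebra_simps)
  then show ?case
    using rat_subspace_uminus[OF D(2) S] less.prems
    by (metis L_def rat_subspace_of_nat_multD[OF D(2)])
qed

section \<open>Congruences between power series\<close>

text \<open>A subring \<open>P\<close> with an ideal \<open>I\<close>, so that series with coefficients in \<open>P\<close> can be compared modulo
  \<open>I\<close> inside the field, without a map to a quotient.\<close>

definition subring_ideal :: "'a::field_char_0 set \<Rightarrow> 'a set \<Rightarrow> bool"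
  where "subring_ideal P I \<longleftrightarrow> rat_subspace P \<and> rat_subspace I \<and> 1 \<in> P \<and> I \<subseteq> P \<and>
    (\<forall>x\<in>P. \<forall>y\<in>P. x * y \<in> P) \<and> (\<forall>x\<in>P. \<forall>y\<in>I. x * y \<in> I)"

lemma subring_idealD:
  assumes "subring_ideal P I"
  shows "rat_subspace P" "rat_subspace I" "1 \<in> P" "x \<in> I \<Longrightarrow> x \<in> P"
    "x \<in> P \<Longrightarrow> y \<in> P \<Longrightarrow> x * y \<in> P" "x \<in> P \<Longrightarrow> y \<in> I \<Longrightarrow> x * y \<in> I"
    "x \<in> I \<Longrightarrow> y \<in> P \<Longrightarrow> x * y \<in> I"
    "filtration_pair (\<lambda>_. P) (\<lambda>_. P)" "filtration_pair (\<lambda>_. I) (\<lambda>_. I)"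
proof -
  have D: "rat_subspace P" "rat_subspace I" "1 \<in> P" "\<And>x. x \<in> I \<Longrightarrow> x \<in> P"
    "\<And>x y. x \<in> P \<Longrightarrow> y \<in> P \<Longrightarrow> x * y \<in> P" "\<And>x y. x \<in> P \<Longrightarrow> y \<in> I \<Longrightarrow> x * y \<in> I"
    using assms by (auto simp: subring_ideal_def)
  show "rat_subspace P" "rat_subspace I" "1 \<in> P" by (fact D)+
  show "x \<in> P" if "x \<in> I" using D(4)[OF that] .
  show "x * y \<in> P" if "x \<in> P" "y \<in> P" using D(5)[OF that] .
  show "x * y \<in> I" if "x \<in> P" "y \<in> I" using D(6)[OF that] .
  show "x * y \<in> I" if "x \<in> I" "y \<in> P" using D(6)[OF that(2,1)] by (simp add: mult.commute)
  show "filtration_pair (\<lambda>_. P) (\<lambda>_. P)" "filtration_pair (\<lambda>_. I) (\<lambda>_. I)"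
    using D(1,2,4,5,6) by (auto simp: filtration_pair_def)
qed

lemma fps_mult_nth_in_ideal:
  assumes "subring_ideal P I" "\<And>n. F $ n \<in> I" "\<And>n. E $ n \<in> P"
  shows "(F * E) $ n \<in> I"
  unfolding fps_mult_nth
  by (intro rat_subspace_sum[OF subring_idealD(2)[OF assms(1)]] subring_idealD(7)[OF assms(1)]
        assms(2,3))

lemma fps_inverse_nth_in_subring:
  fixes F :: "'a::field_char_0 fps"
  assumes P: "subring_ideal P I" and F: "F $ 0 = 1" "\<And>n. F $ n \<in> P"
  shows "inverse F $ n \<in> P"
proof (cases "n = 0")
  case False
  note D = subring_idealD[OF P]
  have "inverse F $ n + F $ n \<in> P"
    using False by (intro fps_inverse_nth_perturb[OF D(8)] F) auto
  from rat_subspace_diff[OF D(1) this F(2)[of n]] show ?thesis by simp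
qed (use F subring_idealD(3)[OF P] in auto)

lemma fps_inverse_nth_cong:
  fixes F E :: "'a::field_char_0 fps"
  assumes P: "subring_ideal P I"
    and F: "F $ 0 = 1" "\<And>n. F $ n \<in> P" and E: "E $ 0 = 1" "\<And>n. E $ n \<in> P"
    and FE: "\<And>n. F $ n - E $ n \<in> I"
  shows "inverse F $ n - inverse E $ n \<in> I"
proof -
  have "inverse F - inverse E = (E - F) * inverse F * inverse E"
  proof -
    have "inverse F * F = 1" "inverse E * E = 1" using F(1) E(1) by (auto simp: inverse_mult_eq_1)
    then show ?thesis by (simp add: algebra_simps)
  qed
  moreover have "(E - F) $ n \<in> I" for n
    using rat_subspace_uminus[OF subring_idealD(2)[OF P] FE[of n]] by simp
  ultimately show ?thesis
    unfolding fps_sub_nth[symmetric]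
    by (metis fps_mult_nth_in_ideal[OF P] fps_inverse_nth_in_subring[OF P] F E)
qed

text \<open>Writing \<open>F = X E\<close>, the series \<open>X - 1 = (F - E) / E\<close> has coefficients in \<open>I\<close>; hence so has \<open>log X\<close>, which is
  \<open>log F - log E\<close>.\<close>

lemma fps_log_nth_cong:
  fixes F E :: "'a::field_char_0 fps"
  assumes P: "subring_ideal P I"
    and F: "F $ 0 = 1" "\<And>n. F $ n \<in> P" and E: "E $ 0 = 1" "\<And>n. E $ n \<in> P"
    and FE: "\<And>n. F $ n - E $ n \<in> I" and n: "n > 0"
  shows "fps_log F $ n - fps_log E $ n \<in> I"
proof -
  note D = subring_idealD[OF P]
  define X where "X = F * inverse E"
  have X0: "X $ 0 = 1" using F E by (simp add: X_def)
  have inv: "inverse E * E = 1" using E(1) by (auto simp: inverse_mult_eq_1)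
  then have "X = (F - E) * inverse E + 1" by (simp add: X_def algebra_simps)
  moreover have "((F - E) * inverse E) $ n \<in> I" for n
    using FE by (intro fps_mult_nth_in_ideal[OF P] fps_inverse_nth_in_subring[OF P] E) simp
  ultimately have XI: "X $ n \<in> I" if "n > 0" for n using that by simp
  have "fps_log X $ n - X $ n \<in> I"
    by (rule fps_log_nth_perturb[OF D(9) X0 XI n])
  then have "fps_log X $ n \<in> I" using rat_subspace_add[OF D(2) _ XI[OF n]] by fastforce
  moreover have "F = X * E" using inv by (simp add: X_def mult.assoc)
  ultimately show ?thesis by (simp add: fps_log_mult X0 E)
qed

lemma power_diff_in_ideal:
  assumes P: "subring_ideal P I" and x: "x \<in> P" "y \<in> P" "x - y \<in> I"
  shows "x ^ n - y ^ n \<in> I"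
proof (induction n)
  case 0
  then show ?case using rat_subspace_0[OF subring_idealD(2)[OF P]] by simp
next
  case (Suc n)
  note D = subring_idealD[OF P]
  have "y ^ n \<in> P" for n
    using x(2) D(3) by (induction n) (auto intro: D(5))
  then have "x * (x ^ n - y ^ n) + y ^ n * (x - y) \<in> I"
    using Suc x by (intro rat_subspace_add[OF D(2)] D(6))
  then show ?case by (simp add: algebra_simps)
qed

section \<open>The product formulas of Euler\<close>

definition q_poch :: "'a::field \<Rightarrow> nat \<Rightarrow> 'a"
  where "q_poch z n = (\<Prod>i=1..n. 1 - z ^ i)"

text \<open>The series \<open>1 / (ct; z)\<^sub>\<infinity>\<close>.\<close>

definition euler_fps :: "'a::field \<Rightarrow> 'a \<Rightarrow> 'a fps"
  where "euler_fps z c = Abs_fps (\<lambda>n. c ^ n / q_poch z n)"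

text \<open>The series \<open>(t; z)\<^sub>\<infinity>\<close>.\<close>

definition euler_inv_fps :: "'a::field \<Rightarrow> 'a fps"
  where "euler_inv_fps z = Abs_fps (\<lambda>n. (- 1) ^ n * z ^ (n * (n - 1) div 2) / q_poch z n)"

lemma q_poch_0 [simp]: "q_poch z 0 = 1"
  and q_poch_Suc: "q_poch z (Suc n) = q_poch z n * (1 - z ^ Suc n)"
  by (simp_all add: q_poch_def)

lemma q_poch_nonzero:
  assumes "\<And>n. n > 0 \<Longrightarrow> z ^ n \<noteq> 1"
  shows "q_poch z n \<noteq> 0"
  unfolding q_poch_def using assms by (fastforce simp: prod_zero_iff)

lemma triangle_Suc: "Suc n * (Suc n - 1) div 2 = n * (n - 1) div 2 + n"
proof -
  have "even (n * (n - 1))" by (cases n) auto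
  then show ?thesis by (cases n) (auto elim!: evenE simp: algebra_simps)
qed

lemma triangle_pred_add: "n * (n - 1) div 2 + n = n * (n + 1) div (2::nat)"
  using triangle_Suc[of n] by (simp add: mult.commute)

lemma triangle_twice: "2 * (n * (n + 1) div 2) = n * (n + 1 :: nat)"
  by (rule dvd_mult_div_cancel) auto

lemma euler_fps_compose:
  "euler_fps z c = euler_fps z 1 oo (fps_const c * fps_X)" for c :: "'a::field"
  by (rule fps_ext) (simp add: euler_fps_def)

context
  fixes z :: "'a::field_char_0"
  assumes z: "\<And>n. n > 0 \<Longrightarrow> z ^ n \<noteq> 1"
begin

text \<open>The factor of \<open>1 / (t; z)\<^sub>\<infinity>\<close> that the substitution \<open>t \<mapsto> zt\<close> cancels. This functional equation,
  read on coefficients or on logarithms, determines everything that is needed about the series.\<close>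

lemma euler_fps_shift:
  "euler_fps z 1 oo (fps_const z * fps_X) = (1 - fps_X) * euler_fps z 1"
proof (rule fps_ext)
  fix n
  have [simp]: "q_poch z n \<noteq> 0" for n using q_poch_nonzero[OF z] .
  show "(euler_fps z 1 oo (fps_const z * fps_X)) $ n = ((1 - fps_X) * euler_fps z 1) $ n"
  proof (cases n)
    case (Suc m)
    have nz: "1 - z ^ Suc m \<noteq> 0" using z[of "Suc m"] by auto
    have "z ^ Suc m * (1 / (p * (1 - z ^ Suc m))) = 1 / (p * (1 - z ^ Suc m)) - 1 / p"
      if "p \<noteq> 0" for p
      using that nz by (simp add: field_simps)
    from this[of "q_poch z m"] show ?thesis
      by (simp add: Suc euler_fps_def left_diff_distrib q_poch_Suc del: power_Suc)
  qed (simp add: euler_fps_def left_diff_distrib)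
qed

lemma euler_inv_fps_shift:
  "euler_inv_fps z = (1 - fps_X) * (euler_inv_fps z oo (fps_const z * fps_X))"
proof (rule fps_ext)
  fix n
  have [simp]: "q_poch z n \<noteq> 0" for n using q_poch_nonzero[OF z] .
  show "euler_inv_fps z $ n = ((1 - fps_X) * (euler_inv_fps z oo (fps_const z * fps_X))) $ n"
  proof (cases n)
    case (Suc m)
    have nz: "1 - z ^ Suc m \<noteq> 0" using z[of "Suc m"] by auto
    have step: "(- 1) ^ Suc m * (z ^ t * z ^ m) / (p * (1 - z ^ Suc m))
       = z ^ Suc m * ((- 1) ^ Suc m * (z ^ t * z ^ m) / (p * (1 - z ^ Suc m)))
          - z ^ m * ((- 1) ^ m * z ^ t / p)" if "p \<noteq> 0" for t p
      using that nz by (simp add: field_simps)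
    have e_Suc: "euler_inv_fps z $ Suc m
        = (- 1) ^ Suc m * (z ^ (m * (m - 1) div 2) * z ^ m) / (q_poch z m * (1 - z ^ Suc m))"
      unfolding euler_inv_fps_def fps_nth_Abs_fps triangle_Suc q_poch_Suc power_add by (rule refl)
    have e_m: "euler_inv_fps z $ m = (- 1) ^ m * z ^ (m * (m - 1) div 2) / q_poch z m"
      by (simp add: euler_inv_fps_def)
    have "euler_inv_fps z $ Suc m
        = z ^ Suc m * euler_inv_fps z $ Suc m - z ^ m * euler_inv_fps z $ m"
      unfolding e_Suc e_m by (rule step) simp
    also have "\<dots> = ((1 - fps_X) * (euler_inv_fps z oo (fps_const z * fps_X))) $ Suc m"
      by (simp add: left_diff_distrib del: power_Suc)
    finally show ?thesis by (simp only: Suc)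
  qed (simp add: euler_inv_fps_def left_diff_distrib)
qed

text \<open>By the two functional equations the product is invariant under \<open>t \<mapsto> zt\<close>. Since \<open>z\<close> is not a root of
  unity, only its constant term survives.\<close>

lemma euler_fps_inverse: "euler_fps z 1 * euler_inv_fps z = 1"
proof -
  define s where "s = fps_const z * fps_X"
  define W where "W = euler_fps z 1 * euler_inv_fps z"
  have "(1 - fps_X) * (W oo s)
      = (euler_fps z 1 oo s) * ((1 - fps_X) * (euler_inv_fps z oo s))"
    by (simp add: W_def s_def fps_compose_mult_distrib mult_ac)
  also have "\<dots> = (1 - fps_X) * W"
    unfolding s_def euler_inv_fps_shift[symmetric] euler_fps_shift W_def by (simp add: mult_ac)
  finally have "(1 - fps_X) * (W oo s) = (1 - fps_X) * W" .
  moreover have "(1 - fps_X :: 'a fps) \<noteq> 0"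
    by (metis fps_one_nth fps_sub_nth fps_X_nth diff_zero fps_zero_nth zero_neq_one)
  ultimately have eq: "W oo s = W" by simp
  show ?thesis unfolding W_def[symmetric]
  proof (rule fps_ext)
    fix n
    have "z ^ n * W $ n = W $ n" using arg_cong[OF eq, of "\<lambda>F. F $ n"] by (simp add: s_def)
    then have "W $ n = 0" if "n > 0" using z[OF that] by auto
    then show "W $ n = 1 $ n"
      by (cases "n = 0") (auto simp: W_def euler_fps_def euler_inv_fps_def)
  qed
qed

text \<open>Taking logarithms in the functional equation turns it into a linear equation
  \<open>z\<^sup>n L\<^sub>n = L\<^sub>n - 1 / n\<close> for each coefficient.\<close>

lemma fps_log_euler_nth:
  assumes "n > 0"
  shows "fps_log (euler_fps z c) $ n = c ^ n / (of_nat n * (1 - z ^ n))"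
proof -
  let ?L = "fps_log (euler_fps z 1)"
  have E0: "euler_fps z 1 $ 0 = 1" by (simp add: euler_fps_def)
  have "?L oo (fps_const z * fps_X) = fps_log (1 - fps_X) + ?L"
    using fps_log_mult[of "1 - fps_X" "euler_fps z 1"] E0
    by (simp add: fps_log_compose_linear[symmetric] euler_fps_shift)
  from arg_cong[OF this, of "\<lambda>F. F $ n"]
  have "z ^ n * ?L $ n = ?L $ n - 1 / of_nat n"
    by (simp add: fps_log_one_minus_X_nth)
  then have "?L $ n = 1 / (of_nat n * (1 - z ^ n))"
    using z[OF assms] assms by (simp add: field_simps)
  then show ?thesis
    by (subst euler_fps_compose) (simp add: fps_log_compose_linear[OF E0])
qed

end

section \<open>The Moebius function\<close>

lemma moebius_mu_prime_mult:
  assumes p: "prime p" and sf: "squarefree e" and ndvd: "\<not> p dvd e"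
  shows "moebius_mu (p * e) = - moebius_mu e"
proof -
  have e: "e \<noteq> 0" using sf by (metis not_squarefree_0)
  have "squarefree (p * e)"
    using prime_imp_coprime[OF p ndvd] squarefree_prime[OF p] sf by (rule squarefree_mult_coprime)
  moreover have "prime_factors (p * e) = insert p (prime_factors e)"
    using p e by (subst prime_factors_product) (auto simp: prime_factorization_prime)
  moreover have "p \<notin> prime_factors e" using ndvd by auto
  ultimately show ?thesis using sf by (simp add: moebius_mu_def)
qed

text \<open>Fix a prime \<open>p\<close> dividing \<open>n\<close>. Only squarefree divisors count, and \<open>e \<mapsto> p e\<close> pairs those prime to \<open>p\<close> with
  those divisible by \<open>p\<close>, reversing the sign.\<close>

lemma sum_moebius_mu_divisors:
  assumes "n \<ge> 2"
  shows "(\<Sum>d | d dvd n. moebius_mu d) = 0"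
proof -
  obtain p where p: "prime p" "p dvd n" using assms prime_factor_nat[of n] by auto
  \<comment> \<open>the squarefree divisors prime to \<open>p\<close>; multiplication by \<open>p\<close> yields the others\<close>
  define A where "A = {d. d dvd n \<and> squarefree d \<and> \<not> p dvd d}"
  have fin: "finite {d. d dvd n}" using assms by simp
  have inj: "inj_on ((*) p) A" using p(1) by (auto simp: inj_on_def prime_gt_0_nat)
  have "{d. d dvd n \<and> squarefree d} = A \<union> (*) p ` A"
  proof (intro equalityI subsetI)
    fix d assume d: "d \<in> {d. d dvd n \<and> squarefree d}"
    show "d \<in> A \<union> (*) p ` A"
    proof (cases "p dvd d")
      case True
      then obtain e where e: "d = p * e" by blast
      have "\<not> p dvd e"
      proof
        assume "p dvd e"
        then have "p ^ 2 dvd d" unfolding e power2_eq_square by (rule mult_dvd_mono[OF dvd_refl])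
        then show False using d p(1) squarefreeD[of d p] by auto
      qed
      then have "e \<in> A" using d e by (auto simp: A_def dest: dvd_mult_right squarefree_multD)
      then show ?thesis using e by blast
    qed (use d in \<open>auto simp: A_def\<close>)
  next
    fix d assume "d \<in> A \<union> (*) p ` A"
    moreover have "p * e dvd n \<and> squarefree (p * e)" if "e \<in> A" for e
    proof -
      have "coprime p e" using that p(1) by (auto simp: A_def prime_imp_coprime)
      then show ?thesis using that p
        by (auto simp: A_def intro: divides_mult squarefree_mult_coprime squarefree_prime)
    qed
    ultimately show "d \<in> {d. d dvd n \<and> squarefree d}" by (auto simp: A_def)
  qed
  moreover have "A \<inter> (*) p ` A = {}" by (auto simp: A_def)
  moreover have finA: "finite A" using fin by (auto simp: A_def)
  ultimately have "(\<Sum>d | d dvd n \<and> squarefree d. moebius_mu d)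
      = (\<Sum>d\<in>A. moebius_mu d) + (\<Sum>d\<in>A. moebius_mu (p * d))"
    by (simp add: sum.union_disjoint sum.reindex[OF inj])
  also have "(\<Sum>d\<in>A. moebius_mu (p * d)) = - (\<Sum>d\<in>A. moebius_mu d)"
    unfolding sum_negf[symmetric]
    by (intro sum.cong refl moebius_mu_prime_mult[OF p(1)]) (auto simp: A_def)
  also have "(\<Sum>d | d dvd n \<and> squarefree d. moebius_mu d) = (\<Sum>d | d dvd n. moebius_mu d)"
    using fin by (intro sum.mono_neutral_left) (auto simp: moebius_mu_def)
  finally show ?thesis by simp
qed

section \<open>Substitutions and the coefficients of the plethystic logarithm\<close>

lemma subst_qu_uminus: "i > 0 \<Longrightarrow> subst_qu i (- x) = - subst_qu i x"
  using subst_qu_add[of i x "- x"] by (simp add: subst_qu_0 eq_neg_iff_add_eq_0 add.commute)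

lemma subst_qu_diff: "i > 0 \<Longrightarrow> subst_qu i (x - y) = subst_qu i x - subst_qu i y"
  using subst_qu_add[of i x "- y"] by (simp add: subst_qu_uminus)

lemma subst_qu_power: "i > 0 \<Longrightarrow> subst_qu i (x ^ n) = subst_qu i x ^ n"
  by (induction n) (auto simp: subst_qu_1 subst_qu_mult)

lemma subst_qu_of_nat: "i > 0 \<Longrightarrow> subst_qu i (of_nat n) = of_nat n"
  by (induction n) (auto simp: subst_qu_0 subst_qu_1 subst_qu_add)

lemma subst_qu_divide:
  assumes "i > 0"
  shows "subst_qu i (x / y) = subst_qu i x / subst_qu i y"
proof (cases "y = 0")
  case False
  then have "subst_qu i y * subst_qu i (1 / y) = 1"
    using assms by (simp add: subst_qu_1 flip: subst_qu_mult)
  then have "subst_qu i y \<noteq> 0" by auto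
  moreover have "subst_qu i (x / y) * subst_qu i y = subst_qu i x"
    using False assms by (simp flip: subst_qu_mult)
  ultimately show ?thesis by (simp add: field_simps)
qed (simp add: assms subst_qu_0)

lemma subst_qu_Suc_0: "subst_qu (Suc 0) x = x"
proof -
  have X: "monom (1 :: 'a :: idom) (Suc 0) = [:0, 1:]" by (simp add: monom_altdef)
  have "subst_q (Suc 0) y = y" for y
    by (cases y) (simp add: subst_q_Fract X)
  then have "map_poly (subst_q (Suc 0)) p = p" for p
    by (simp add: map_poly_idI)
  then show ?thesis by (cases x) (simp add: subst_qu_Fract X)
qed

lemma subst_qut_nth:
  "subst_qut i F $ n = (if i dvd n then subst_qu i (F $ (n div i)) else 0)"
  unfolding subst_qut_def by (simp add: fps_nth_compose_X_power)

text \<open>The \<open>i\<close>-th summand is a series in \<open>t\<^sup>i\<close>, so only the divisors of \<open>n\<close> contribute, and the \<open>t\<close>-adic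
  limit is reached after \<open>n\<close> summands.\<close>

lemma pleth_Log_nth:
  assumes "n > 0"
  shows "pleth_Log P $ n
    = (\<Sum>i | i dvd n. of_int (moebius_mu i) / of_nat i * subst_qu i (fps_log P $ (n div i)))"
proof -
  define f where "f = (\<lambda>i. fps_const (of_int (moebius_mu i) / of_nat i) * subst_qut i (fps_log P))"
  have f_nth: "f i $ n = (if i dvd n then of_int (moebius_mu i) / of_nat i
      * subst_qu i (fps_log P $ (n div i)) else 0)" for i
    by (simp add: f_def subst_qut_nth)
  have "(\<Sum>i<m. f (Suc i)) $ n = (\<Sum>i | i dvd n. f i $ n)" if "n \<le> m" for m
  proof -
    have "(\<Sum>i<m. f (Suc i)) $ n = (\<Sum>i\<in>{1..m}. f i $ n)"
      unfolding fps_sum_nth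
      by (rule sum.reindex_bij_witness[of _ "\<lambda>i. i - 1" Suc]) auto
    also have "\<dots> = (\<Sum>i | i dvd n. f i $ n)"
    proof (intro sum.mono_neutral_right)
      show "{i. i dvd n} \<subseteq> {1..m}"
      proof
        fix i assume "i \<in> {i. i dvd n}"
        then have "i \<le> n" "i > 0" using assms by (auto intro: dvd_imp_le dvd_pos_nat)
        then show "i \<in> {1..m}" using that by auto
      qed
    qed (auto simp: f_nth)
    finally show ?thesis .
  qed
  moreover have "\<forall>\<^sub>F m in sequentially. (\<Sum>i<m. f (Suc i)) $ n = pleth_Log P $ n"
    using pleth_Log_sums[of P] unfolding sums_def tendsto_fps_iff f_def fps_log_def by blast
  ultimately have "pleth_Log P $ n = (\<Sum>i | i dvd n. f i $ n)"
    unfolding eventually_sequentially by (metis nle_le)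
  then show ?thesis by (auto simp: f_nth intro: sum.cong)
qed

section \<open>Polynomials with exponents in a given range\<close>

text \<open>The elements of \<open>\<rat>(q)[u]\<close> whose exponents lie in \<open>[a, b]\<close>. The lower bound records divisibility by
  \<open>u\<^sup>a\<close>, the upper one the degree; \<open>upoly 0 0\<close> is the field \<open>\<rat>(q)\<close>.\<close>

definition upoly :: "nat \<Rightarrow> nat \<Rightarrow> Qqu set"
  where "upoly a b = of_upoly ` {p. \<forall>k. coeff p k \<noteq> 0 \<longrightarrow> a \<le> k \<and> k \<le> b}"

lemma of_upoly_0 [simp]: "of_upoly 0 = 0"
  and of_upoly_1 [simp]: "of_upoly 1 = 1"
  and of_upoly_add: "of_upoly (x + y) = of_upoly x + of_upoly y"
  and of_upoly_mult: "of_upoly (x * y) = of_upoly x * of_upoly y"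
  and of_upoly_uminus: "of_upoly (- x) = - of_upoly x"
  and of_upoly_eq_iff [simp]: "of_upoly x = of_upoly y \<longleftrightarrow> x = y"
  by (simp_all add: of_upoly_def Zero_fract_def[where 'a = "Qq poly"]
      One_fract_def[where 'a = "Qq poly"] eq_fract)

lemma of_upoly_diff: "of_upoly (x - y) = of_upoly x - of_upoly y"
  by (simp add: diff_conv_add_uminus of_upoly_add of_upoly_uminus del: add_uminus_conv_diff)

lemma upolyI: "(\<And>k. coeff p k \<noteq> 0 \<Longrightarrow> a \<le> k \<and> k \<le> b) \<Longrightarrow> of_upoly p \<in> upoly a b"
  by (auto simp: upoly_def)

lemma upolyE:
  assumes "x \<in> upoly a b"
  obtains p where "x = of_upoly p" "\<forall>k. coeff p k \<noteq> 0 \<longrightarrow> a \<le> k \<and> k \<le> b"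
  using assms by (auto simp: upoly_def)

lemma upoly_mono: "x \<in> upoly a b \<Longrightarrow> a' \<le> a \<Longrightarrow> b \<le> b' \<Longrightarrow> x \<in> upoly a' b'"
  unfolding upoly_def by fastforce

lemma zero_in_upoly: "0 \<in> upoly a b"
  using upolyI[of 0 a b] by simp

lemma upoly_add:
  assumes "x \<in> upoly a b" "y \<in> upoly a b"
  shows "x + y \<in> upoly a b"
proof -
  obtain p where p: "x = of_upoly p" "\<forall>k. coeff p k \<noteq> 0 \<longrightarrow> a \<le> k \<and> k \<le> b"
    using assms(1) by (rule upolyE)
  obtain r where r: "y = of_upoly r" "\<forall>k. coeff r k \<noteq> 0 \<longrightarrow> a \<le> k \<and> k \<le> b"
    using assms(2) by (rule upolyE)
  have "of_upoly (p + r) \<in> upoly a b"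
    by (rule upolyI) (use p(2) r(2) in \<open>metis add_0 coeff_add\<close>)
  then show ?thesis by (simp add: p(1) r(1) of_upoly_add)
qed

lemma upoly_mult:
  assumes "x \<in> upoly a b" "y \<in> upoly c d"
  shows "x * y \<in> upoly (a + c) (b + d)"
proof -
  obtain p where p: "x = of_upoly p" "\<forall>k. coeff p k \<noteq> 0 \<longrightarrow> a \<le> k \<and> k \<le> b"
    using assms(1) by (rule upolyE)
  obtain r where r: "y = of_upoly r" "\<forall>k. coeff r k \<noteq> 0 \<longrightarrow> c \<le> k \<and> k \<le> d"
    using assms(2) by (rule upolyE)
  have "of_upoly (p * r) \<in> upoly (a + c) (b + d)"
  proof (rule upolyI)
    fix k assume "coeff (p * r) k \<noteq> 0"
    then obtain i where i: "i \<le> k" "coeff p i * coeff r (k - i) \<noteq> 0"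
      unfolding coeff_mult by (auto elim: sum.not_neutral_contains_not_neutral)
    then have "a \<le> i \<and> i \<le> b" "c \<le> k - i \<and> k - i \<le> d"
      using p(2) r(2) by auto
    then show "a + c \<le> k \<and> k \<le> b + d" using i(1) by linarith
  qed
  then show ?thesis by (simp add: p(1) r(1) of_upoly_mult)
qed

lemma const_in_upoly: "of_upoly [:c:] \<in> upoly 0 0"
  by (rule upolyI) (simp add: coeff_pCons split: nat.splits)

lemma upoly_0_0E:
  assumes "x \<in> upoly 0 0"
  obtains c where "x = of_upoly [:c:]"
proof -
  obtain p where p: "x = of_upoly p" "\<forall>k. coeff p k \<noteq> 0 \<longrightarrow> 0 \<le> k \<and> k \<le> 0"
    by (rule upolyE[OF assms])
  then have "p = [:coeff p 0:]"
    by (intro poly_eqI) (auto simp: coeff_pCons split: nat.splits)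
  then show ?thesis using p(1) that by metis
qed

lemma one_in_upoly: "1 \<in> upoly 0 0"
  using const_in_upoly[of 1] by (simp add: one_pCons[symmetric])

lemma q_in_upoly: "q \<in> upoly 0 0"
  unfolding q_def by (rule const_in_upoly)

lemma upoly_const_mult: "c \<in> upoly 0 0 \<Longrightarrow> x \<in> upoly a b \<Longrightarrow> c * x \<in> upoly a b"
  using upoly_mult[of c 0 0 x a b] by simp

lemma upoly_uminus: "x \<in> upoly a b \<Longrightarrow> - x \<in> upoly a b"
proof -
  assume "x \<in> upoly a b"
  moreover have "of_upoly [:-1:] = -1"
    by (metis of_upoly_1 of_upoly_uminus one_pCons minus_pCons minus_zero)
  ultimately show ?thesis
    using upoly_const_mult[OF const_in_upoly, of x a b "-1"] by simp
qed

lemma upoly_diff: "x \<in> upoly a b \<Longrightarrow> y \<in> upoly a b \<Longrightarrow> x - y \<in> upoly a b"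
  using upoly_add[of x a b "- y"] upoly_uminus[of y] by simp

lemma upoly_sum: "(\<And>i. i \<in> A \<Longrightarrow> f i \<in> upoly a b) \<Longrightarrow> sum f A \<in> upoly a b"
  by (induction A rule: infinite_finite_induct) (auto simp: zero_in_upoly upoly_add)

lemma upoly_power: "x \<in> upoly a b \<Longrightarrow> x ^ n \<in> upoly (n * a) (n * b)"
  by (induction n) (auto simp: one_in_upoly dest: upoly_mult)

lemma upoly_const_power: "x \<in> upoly 0 0 \<Longrightarrow> x ^ n \<in> upoly 0 0"
  using upoly_power[of x 0 0 n] by simp

lemma upoly_const_prod: "(\<And>i. i \<in> A \<Longrightarrow> f i \<in> upoly 0 0) \<Longrightarrow> prod f A \<in> upoly 0 0"
  by (induction A rule: infinite_finite_induct) (auto simp: one_in_upoly upoly_const_mult)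

lemma upoly_const_inverse:
  assumes "x \<in> upoly 0 0"
  shows "inverse x \<in> upoly 0 0"
proof -
  obtain c where c: "x = of_upoly [:c:]" using assms by (elim upoly_0_0E)
  have "x * of_upoly [:inverse c:] = 1" if "c \<noteq> 0"
    using that by (simp add: c flip: of_upoly_mult one_pCons)
  then show ?thesis
    using const_in_upoly[of "inverse c"] zero_in_upoly c by (cases "c = 0") (auto dest: inverse_unique)
qed

lemma upoly_const_divide: "x \<in> upoly a b \<Longrightarrow> c \<in> upoly 0 0 \<Longrightarrow> x / c \<in> upoly a b"
  using upoly_const_mult[OF upoly_const_inverse, of c x a b] by (simp add: divide_inverse mult.commute)

lemma of_nat_in_upoly: "of_nat n \<in> upoly 0 0"
  by (induction n) (auto simp: zero_in_upoly one_in_upoly upoly_add)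

lemma of_int_in_upoly: "of_int n \<in> upoly 0 0"
  by (cases n) (auto intro: upoly_uminus of_nat_in_upoly upoly_diff simp: one_in_upoly simp del: of_nat_Suc)

lemma of_rat_in_upoly: "of_rat r \<in> upoly 0 0"
  by (cases r) (auto simp: of_rat_rat intro: upoly_const_divide of_int_in_upoly)

lemma rat_subspace_upoly: "rat_subspace (upoly a b)"
  unfolding rat_subspace_def
  by (auto intro: zero_in_upoly upoly_add upoly_const_mult of_rat_in_upoly)

lemma u_power_in_upoly: "u ^ n \<in> upoly n n"
proof -
  have "u \<in> upoly 1 1"
    unfolding u_def by (rule upolyI) (auto simp: coeff_pCons split: nat.splits)
  then show ?thesis using upoly_power[of u 1 1 n] by simp
qed

lemma subst_qu_upoly:
  assumes "i > 0" "x \<in> upoly a b"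
  shows "subst_qu i x \<in> upoly (i * a) (i * b)"
proof -
  obtain p where p: "x = of_upoly p" "\<forall>k. coeff p k \<noteq> 0 \<longrightarrow> a \<le> k \<and> k \<le> b"
    by (rule upolyE[OF assms(2)])
  have sc: "subst_qu i (of_upoly [:c:]) \<in> upoly 0 0" for c
    using assms(1) by (simp add: of_upoly_def subst_qu_Fract subst_q_1 pcompose_1 map_poly_pCons
      subst_q_0 const_in_upoly[unfolded of_upoly_def])
  have su: "subst_qu i (sum f A) = (\<Sum>k\<in>A. subst_qu i (f k))" for f and A :: "nat set"
    by (induction A rule: infinite_finite_induct) (auto simp: subst_qu_0 subst_qu_add assms)
  \<comment> \<open>expand \<open>x\<close> in powers of \<open>u\<close>; each exponent gets multiplied by \<open>i\<close>\<close>
  have "p = (\<Sum>k\<le>degree p. [:coeff p k:] * [:0, 1:] ^ k)"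
    using poly_as_sum_of_monoms[of p] by (simp add: monom_altdef)
  moreover have "of_upoly (sum f A) = (\<Sum>k\<in>A. of_upoly (f k))" for f and A :: "nat set"
    by (induction A rule: infinite_finite_induct) (auto simp: of_upoly_add)
  ultimately have "x = (\<Sum>k\<le>degree p. of_upoly [:coeff p k:] * u ^ k)"
    unfolding p(1) u_def of_upoly_power of_upoly_mult[symmetric] by metis
  then have "subst_qu i x = (\<Sum>k\<le>degree p. subst_qu i (of_upoly [:coeff p k:]) * (u ^ i) ^ k)"
    using assms(1) by (simp add: su subst_qu_power subst_qu_mult subst_qu_u)
  also have "\<dots> \<in> upoly (i * a) (i * b)"
  proof (rule upoly_sum)
    fix k
    show "subst_qu i (of_upoly [:coeff p k:]) * (u ^ i) ^ k \<in> upoly (i * a) (i * b)"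
    proof (cases "coeff p k = 0")
      case True
      then show ?thesis using assms by (simp add: subst_qu_0 zero_in_upoly)
    next
      case False
      have "(u ^ i) ^ k \<in> upoly (i * k) (i * k)"
        using u_power_in_upoly[of "i * k"] by (simp add: power_mult)
      then show ?thesis
        using p(2)[rule_format, OF False] by (intro upoly_const_mult[OF sc]) (auto intro: upoly_mono)
    qed
  qed
  finally show ?thesis .
qed

section \<open>Multiples of a polynomial\<close>

text \<open>The principal ideal generated by \<open>x\<close> in \<open>\<rat>(q)[u]\<close>.\<close>

definition multiples_of :: "Qqu \<Rightarrow> Qqu set"
  where "multiples_of x = (\<lambda>p. x * of_upoly p) ` UNIV"

lemma upoly_imp_range: "x \<in> upoly a b \<Longrightarrow> x \<in> range of_upoly"
  by (auto elim: upolyE)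

lemma subring_ideal_multiples:
  assumes "x \<in> range of_upoly"
  shows "subring_ideal (range of_upoly) (multiples_of x)"
proof -
  let ?P = "range of_upoly"
  have m: "y * z \<in> ?P" if "y \<in> ?P" "z \<in> ?P" for y z
    using that by (auto simp flip: of_upoly_mult)
  have a: "y + z \<in> ?P" if "y \<in> ?P" "z \<in> ?P" for y z
    using that by (auto simp flip: of_upoly_add)
  have r: "of_rat t \<in> ?P" for t
    by (rule upoly_imp_range[OF of_rat_in_upoly])
  have 0: "0 \<in> ?P" and 1: "1 \<in> ?P"
    by (rule upoly_imp_range, rule zero_in_upoly) (rule upoly_imp_range, rule one_in_upoly)
  have P: "rat_subspace ?P"
    unfolding rat_subspace_def using 0 by (intro conjI ballI allI a m r)
  have I: "multiples_of x = (\<lambda>z. x * z) ` ?P"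
    by (simp add: multiples_of_def image_image)
  have mI: "y * z \<in> multiples_of x" if y: "y \<in> ?P" and z: "z \<in> multiples_of x" for y z
  proof -
    obtain w where w: "w \<in> ?P" "z = x * w" using z unfolding I by (rule imageE)
    have "y * z = x * (y * w)" using w(2) by (simp only: mult.left_commute)
    then show ?thesis unfolding I using m[OF y w(1)] by (rule image_eqI)
  qed
  have aI: "y + z \<in> multiples_of x" if y: "y \<in> multiples_of x" and z: "z \<in> multiples_of x" for y z
  proof -
    obtain v where v: "v \<in> ?P" "y = x * v" using y unfolding I by (rule imageE)
    obtain w where w: "w \<in> ?P" "z = x * w" using z unfolding I by (rule imageE)
    have "y + z = x * (v + w)" by (simp only: v(2) w(2) distrib_left)
    then show ?thesis unfolding I using a[OF v(1) w(1)] by (rule image_eqI)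
  qed
  have "0 \<in> multiples_of x" unfolding I by (rule image_eqI[OF _ 0]) simp
  then have R: "rat_subspace (multiples_of x)"
    unfolding rat_subspace_def by (intro conjI ballI allI aI mI r)
  have "multiples_of x \<subseteq> ?P" unfolding I by (rule image_subsetI) (rule m[OF assms])
  then show ?thesis
    unfolding subring_ideal_def by (intro conjI ballI P R 1 m mI)
qed

lemma u_in_range: "u \<in> range of_upoly"
  by (simp add: u_def)

lemma subst_qu_range: "i > 0 \<Longrightarrow> x \<in> range of_upoly \<Longrightarrow> subst_qu i x \<in> range of_upoly"
  by (auto simp: of_upoly_def subst_qu_Fract subst_q_1 pcompose_1)

text \<open>Only specialisations \<open>u = c\<close> compatible with the substitution, such as \<open>c = 1\<close> and \<open>c = q\<close>, behave
  well: then \<open>u - c\<close> is sent to \<open>u\<^sup>i - c\<^sup>i\<close>, again a multiple of \<open>u - c\<close>.\<close>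

lemma subst_qu_multiples:
  assumes i: "i > 0" and c: "c \<in> range of_upoly" "subst_qu i c = c ^ i"
    and x: "x \<in> multiples_of (u - c)"
  shows "subst_qu i x \<in> multiples_of (u - c)"
proof -
  have P: "u - c \<in> range of_upoly"
    using c(1) by (auto simp: u_def simp flip: of_upoly_diff)
  note I = subring_ideal_multiples[OF this]
  obtain p where p: "x = (u - c) * of_upoly p" using x by (auto simp: multiples_of_def)
  have "u - c \<in> multiples_of (u - c)"
    unfolding multiples_of_def by (rule image_eqI[of _ _ 1]) auto
  then have "(u ^ i - c ^ i) * subst_qu i (of_upoly p) \<in> multiples_of (u - c)"
    by (intro subring_idealD(7)[OF I] power_diff_in_ideal[OF I] u_in_range c(1) subst_qu_range i)
       auto
  then show ?thesis using i c(2) by (simp add: p subst_qu_mult subst_qu_diff subst_qu_u)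
qed

lemma multiples_of_imp_root:
  assumes "of_upoly p \<in> multiples_of (u - of_upoly [:c:])"
  shows "poly p c = 0"
proof -
  obtain r where "of_upoly p = (u - of_upoly [:c:]) * of_upoly r"
    using assms by (auto simp: multiples_of_def)
  then have "of_upoly p = of_upoly (([:0, 1:] - [:c:]) * r)"
    by (simp only: u_def of_upoly_mult of_upoly_diff)
  then have "p = ([:0, 1:] - [:c:]) * r" by (simp only: of_upoly_eq_iff)
  then show ?thesis by simp
qed

section \<open>The series behind the polynomials\<close>

lemma q_power_neq_1:
  assumes "n > 0"
  shows "q ^ n \<noteq> 1"
proof
  assume "q ^ n = 1"
  then have "of_upoly ([:q_base:] ^ n) = of_upoly 1"
    by (simp add: q_def of_upoly_power)
  then have "[:q_base ^ n:] = [:1:]"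
    unfolding of_upoly_eq_iff by (simp add: poly_const_pow one_pCons)
  then have "q_base ^ n = 1" by simp
  moreover have "q_base ^ n = Fract ([:0, 1:] ^ n) 1"
    unfolding q_base_def by (induction n) (auto simp: One_fract_def)
  ultimately have "[:0, 1 :: rat:] ^ n = 1" by (simp add: One_fract_def eq_fract)
  then have "degree ([:0, 1 :: rat:] ^ n) = 0" by simp
  then show False using assms by (simp add: degree_power_eq)
qed

lemma q_poch_q_nonzero: "q_poch q n \<noteq> 0"
  by (rule q_poch_nonzero[OF q_power_neq_1])

lemma euler_fps_q_inverse: "euler_fps q 1 * euler_inv_fps q = 1"
  by (rule euler_fps_inverse) (rule q_power_neq_1)

lemma fps_log_euler_q_nth:
  "n > 0 \<Longrightarrow> fps_log (euler_fps q c) $ n = c ^ n / (of_nat n * (1 - q ^ n))"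
  by (rule fps_log_euler_nth) (rule q_power_neq_1)

lemma q_poch_in_upoly: "q_poch q n \<in> upoly 0 0"
  unfolding q_poch_def
  by (intro upoly_const_prod upoly_diff one_in_upoly upoly_const_power q_in_upoly)

text \<open>The series whose plethystic logarithm generates the \<open>a\<^sub>d\<close>.\<close>

definition F_ser :: "Qqu fps"
  where "F_ser = inv T_op (inverse G_ser)"

lemma G_ser_nth: "G_ser $ d = u ^ (d * (d + 1) div 2) / q_poch q d"
  by (simp add: G_ser_def q_poch_def)

lemma minus_one_power_square: "(- 1) ^ n * (- 1) ^ n = (1 :: 'a :: comm_ring_1)"
  by (simp flip: power_mult_distrib)

lemma F_ser_nth: "F_ser $ d = (- 1) ^ d * (u / q) ^ (d * (d - 1) div 2) * inverse G_ser $ d"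
proof -
  have T: "T_op F_ser = inverse G_ser"
    unfolding F_ser_def by (rule surj_f_inv_f[OF bij_is_surj[OF bij_T_op]])
  define w where "w = (u / q) ^ (d * (d - 1) div 2)"
  have w: "w \<noteq> 0" using q_nonzero u_nonzero by (simp add: w_def)
  have G: "inverse G_ser $ d = (- 1) ^ d * inverse w * F_ser $ d"
    unfolding T[symmetric] T_op_def w_def by (simp add: divide_inverse mult.commute)
  have "(- 1) ^ d * w * inverse G_ser $ d = ((- 1) ^ d * (- 1) ^ d) * (w * inverse w) * F_ser $ d"
    unfolding G by (simp only: mult_ac)
  also have "\<dots> = F_ser $ d" using w by (simp add: minus_one_power_square)
  finally show ?thesis unfolding w_def ..
qed

lemma G_ser_0: "G_ser $ 0 = 1" and F_ser_0: "F_ser $ 0 = 1"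
  by (simp_all add: F_ser_nth G_ser_nth)

lemma a_pol_eq: "a_pol d = (1 - q) * pleth_Log F_ser $ d"
  unfolding a_pol_def F_ser_def by (rule fps_mult_left_const_nth)

text \<open>The coefficient of \<open>t\<close> is linear in the series: the perturbation lemmas apply with nothing
  neglected in degree \<open>1\<close> and everything neglected above.\<close>

lemma a_pol_1: "a_pol 1 = u"
proof -
  define N where "N = (\<lambda>n::nat. if n \<le> 1 then {0::Qqu} else UNIV)"
  have fp: "filtration_pair (\<lambda>_. UNIV) N"
    by (auto simp: filtration_pair_def rat_subspace_def N_def)
  have "inverse G_ser $ 1 + G_ser $ 1 \<in> N 1"
    by (rule fps_inverse_nth_perturb[OF fp G_ser_0]) auto
  then have "inverse G_ser $ 1 = - G_ser $ 1"
    by (simp add: N_def eq_neg_iff_add_eq_0)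
  then have F1: "F_ser $ 1 = u / (1 - q)"
    by (simp add: F_ser_nth G_ser_nth q_poch_def)
  have "fps_log F_ser $ 1 - F_ser $ 1 \<in> N 1"
    by (rule fps_log_nth_perturb[OF fp F_ser_0]) auto
  then have L1: "fps_log F_ser $ 1 = u / (1 - q)" unfolding F1 by (simp add: N_def)
  have "pleth_Log F_ser $ 1 = of_int (moebius_mu 1) * subst_qu 1 (fps_log F_ser $ 1)"
    by (subst pleth_Log_nth) auto
  also have "\<dots> = u / (1 - q)"
    using L1 by (simp add: moebius_mu_def subst_qu_Suc_0)
  finally show ?thesis using q_power_neq_1[of 1] by (simp add: a_pol_eq)
qed

section \<open>Roots at 1 and q\<close>

text \<open>The plethystic logarithm of \<open>1 / (ct; q)\<^sub>\<infinity>\<close> is \<open>ct / (1 - q)\<close>. For every divisor \<open>i\<close> of \<open>n\<close> the substitution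
  sends the logarithmic coefficient of index \<open>n / i\<close> to \<open>i\<close> times that of index \<open>n\<close>, so the sum
  over \<open>i\<close> is a multiple of the sum of the Moebius function over the divisors of \<open>n\<close>.\<close>

lemma pleth_Log_euler_nth:
  assumes "n \<ge> 2" and c: "\<And>i. i > 0 \<Longrightarrow> subst_qu i c = c ^ i"
  shows "pleth_Log (euler_fps q c) $ n = 0"
proof -
  have "pleth_Log (euler_fps q c) $ n
      = (\<Sum>i | i dvd n. of_int (moebius_mu i) / of_nat i * subst_qu i (fps_log (euler_fps q c) $ (n div i)))"
    using assms by (intro pleth_Log_nth) auto
  also have "\<dots> = (\<Sum>i | i dvd n. of_int (moebius_mu i) * (c ^ n / (of_nat n * (1 - q ^ n))))"
  proof (rule sum.cong[OF refl])
    fix i assume "i \<in> {i. i dvd n}"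
    then obtain m where m: "n = i * m" by auto
    have i: "i > 0" "m > 0" using assms(1) unfolding m by (auto intro!: gr0I)
    have "subst_qu i (fps_log (euler_fps q c) $ m)
        = (c ^ i) ^ m / (of_nat m * (1 - (q ^ i) ^ m))"
      unfolding fps_log_euler_q_nth[OF i(2)]
      using i by (simp add: c subst_qu_divide subst_qu_mult subst_qu_diff subst_qu_power
        subst_qu_of_nat subst_qu_q subst_qu_1)
    then show "of_int (moebius_mu i) / of_nat i * subst_qu i (fps_log (euler_fps q c) $ (n div i))
        = of_int (moebius_mu i) * (c ^ n / (of_nat n * (1 - q ^ n)))"
      using i by (simp add: m power_mult[symmetric] mult_ac)
  qed
  also have "\<dots> = of_int (\<Sum>i | i dvd n. moebius_mu i) * (c ^ n / (of_nat n * (1 - q ^ n)))"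
    by (simp only: of_int_sum sum_distrib_right)
  also have "\<dots> = 0" using assms by (simp add: sum_moebius_mu_divisors)
  finally show ?thesis .
qed

text \<open>The last hypothesis says that specialising \<open>u\<close> to \<open>c\<close> turns \<^const>\<open>F_ser\<close> into \<open>1 / (ct; q)\<^sub>\<infinity>\<close>. This series has
  a linear plethystic logarithm, and inverses, logarithms and the substitutions all respect
  congruences modulo \<open>u - c\<close>.\<close>

lemma a_pol_in_multiples:
  assumes d: "d \<ge> 2"
    and c: "c \<in> upoly 0 0" "\<And>i. i > 0 \<Longrightarrow> subst_qu i c = c ^ i"
    and K_inv: "\<And>n. (- 1) ^ n * (c / q) ^ (n * (n - 1) div 2)
      * inverse (Abs_fps (\<lambda>n. c ^ (n * (n + 1) div 2) / q_poch q n)) $ n = c ^ n / q_poch q n"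
  shows "a_pol d \<in> multiples_of (u - c)"
proof -
  \<comment> \<open>the specialisations of \<^const>\<open>G_ser\<close> and of \<^const>\<open>F_ser\<close> at \<open>u = c\<close>\<close>
  define K where "K = Abs_fps (\<lambda>n. c ^ (n * (n + 1) div 2) / q_poch q n)"
  define E where "E = euler_fps q c"
  let ?P = "range of_upoly" and ?I = "multiples_of (u - c)"
  have cP: "c \<in> ?P" using c(1) by (rule upoly_imp_range)
  have "u - c \<in> ?P" using cP by (auto simp: u_def simp flip: of_upoly_diff)
  note I = subring_ideal_multiples[OF this]
  note D = subring_idealD[OF I]
  have uc: "u - c \<in> ?I"
    unfolding multiples_of_def by (rule image_eqI[of _ _ 1]) auto
  have up: "u ^ m \<in> ?P" for m using u_power_in_upoly by (rule upoly_imp_range)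
  have q0: "1 / q_poch q n \<in> upoly 0 0" for n
    by (intro upoly_const_divide one_in_upoly q_poch_in_upoly)
  have GP: "G_ser $ n \<in> ?P" for n
    unfolding G_ser_nth
    by (rule upoly_imp_range, rule upoly_const_divide, rule u_power_in_upoly, rule q_poch_in_upoly)
  have KP: "K $ n \<in> ?P" for n
    unfolding K_def fps_nth_Abs_fps
    by (rule upoly_imp_range, rule upoly_const_divide, rule upoly_const_power, rule c(1), rule q_poch_in_upoly)
  have EP: "E $ n \<in> ?P" for n
    unfolding E_def euler_fps_def fps_nth_Abs_fps
    by (rule upoly_imp_range, rule upoly_const_divide, rule upoly_const_power, rule c(1), rule q_poch_in_upoly)
  have pow: "u ^ m - c ^ m \<in> ?I" for m
    by (rule power_diff_in_ideal[OF I u_in_range cP uc])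
  have GK: "G_ser $ n - K $ n \<in> ?I" for n
  proof -
    have "G_ser $ n - K $ n = (1 / q_poch q n) * (u ^ (n * (n + 1) div 2) - c ^ (n * (n + 1) div 2))"
      by (simp add: G_ser_nth K_def diff_divide_distrib)
    then show ?thesis using D(6)[OF upoly_imp_range[OF q0] pow] by metis
  qed
  have K0: "K $ 0 = 1" by (simp add: K_def)
  have E0: "E $ 0 = 1" by (simp add: E_def euler_fps_def)
  \<comment> \<open>the part of the inverse of \<open>T\<close> that does not involve \<open>u\<close>\<close>
  define s where "s n = (- 1) ^ n / q ^ (n * (n - 1) div 2)" for n
  have sP: "s n \<in> ?P" for n
  proof -
    have "s n \<in> upoly 0 0" unfolding s_def
      by (intro upoly_const_divide upoly_const_power upoly_uminus one_in_upoly q_in_upoly)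
    then show ?thesis by (rule upoly_imp_range)
  qed
  have FP: "F_ser $ n \<in> ?P" for n
  proof -
    have "F_ser $ n = s n * (u ^ (n * (n - 1) div 2) * inverse G_ser $ n)"
      by (simp add: F_ser_nth s_def power_divide)
    then show ?thesis
      using D(5)[OF sP D(5)[OF up fps_inverse_nth_in_subring[OF I G_ser_0 GP]]] by metis
  qed
  have FE: "F_ser $ n - E $ n \<in> ?I" for n
  proof -
    let ?t = "n * (n - 1) div 2"
    have "E $ n = s n * (c ^ ?t * inverse K $ n)"
      unfolding E_def euler_fps_def fps_nth_Abs_fps K_inv[symmetric] K_def s_def
      by (simp add: power_divide)
    then have "F_ser $ n - E $ n = s n * (u ^ ?t * (inverse G_ser $ n - inverse K $ n)
        + inverse K $ n * (u ^ ?t - c ^ ?t))"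
      by (simp add: F_ser_nth s_def power_divide algebra_simps diff_divide_distrib)
    moreover have "u ^ ?t * (inverse G_ser $ n - inverse K $ n) \<in> ?I"
      by (rule D(6)[OF up fps_inverse_nth_cong[OF I G_ser_0 GP K0 KP GK]])
    moreover have "inverse K $ n * (u ^ ?t - c ^ ?t) \<in> ?I"
      by (rule D(6)[OF fps_inverse_nth_in_subring[OF I K0 KP] pow])
    ultimately show ?thesis
      using D(6)[OF sP rat_subspace_add[OF D(2)]] by metis
  qed
  have L: "fps_log F_ser $ n - fps_log E $ n \<in> ?I" if "n > 0" for n
    by (rule fps_log_nth_cong[OF I F_ser_0 FP E0 EP FE that])
  have "pleth_Log F_ser $ d - pleth_Log E $ d = (\<Sum>i | i dvd d. of_int (moebius_mu i) / of_nat i *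
      subst_qu i (fps_log F_ser $ (d div i) - fps_log E $ (d div i)))"
    using d unfolding pleth_Log_nth[of d F_ser, OF less_le_trans[OF _ d], simplified]
      pleth_Log_nth[of d E, OF less_le_trans[OF _ d], simplified] sum_subtractf[symmetric]
    by (intro sum.cong refl) (auto simp: subst_qu_diff algebra_simps dvd_pos_nat diff_divide_distrib)
  also have "\<dots> \<in> ?I"
  proof (rule rat_subspace_sum[OF D(2)])
    fix i assume "i \<in> {i. i dvd d}"
    then obtain m where m: "d = i * m" by auto
    have "i > 0" "m > 0" using d unfolding m by (auto intro!: gr0I)
    then have i: "i > 0" "d div i > 0" by (simp_all add: m)
    have "of_int (moebius_mu i) / of_nat i \<in> ?P"
      by (rule upoly_imp_range[of _ 0 0], intro upoly_const_divide of_int_in_upoly of_nat_in_upoly)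
    then show "of_int (moebius_mu i) / of_nat i *
      subst_qu i (fps_log F_ser $ (d div i) - fps_log E $ (d div i)) \<in> ?I"
      by (rule D(6)) (rule subst_qu_multiples[OF i(1) cP c(2)[OF i(1)] L[OF i(2)]])
  qed
  finally have "pleth_Log F_ser $ d \<in> ?I"
    using pleth_Log_euler_nth[OF d c(2)] by (simp add: E_def)
  moreover have "1 - q \<in> ?P"
    by (rule upoly_imp_range, rule upoly_diff, rule one_in_upoly, rule q_in_upoly)
  ultimately show ?thesis unfolding a_pol_eq by (intro D(6))
qed

text \<open>At \<open>u = 1\<close> the series \<^const>\<open>G_ser\<close> becomes \<open>1 / (t; q)\<^sub>\<infinity>\<close>, with inverse \<open>(t; q)\<^sub>\<infinity>\<close>, and the inverse of \<open>T\<close> cancels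
  the signs and the powers of \<open>q\<close> there.\<close>

lemma a_pol_multiple_u_minus_1:
  assumes "d \<ge> 2"
  shows "a_pol d \<in> multiples_of (u - 1)"
proof (rule a_pol_in_multiples[OF assms one_in_upoly])
  fix n :: nat
  have "Abs_fps (\<lambda>n. 1 ^ (n * (n + 1) div 2) / q_poch q n) = euler_fps q 1"
    by (simp add: euler_fps_def)
  moreover have "inverse (euler_fps q 1) = euler_inv_fps q"
    using euler_fps_q_inverse by (rule fps_inverse_unique)
  ultimately have "(- 1) ^ n * (1 / q) ^ (n * (n - 1) div 2)
      * inverse (Abs_fps (\<lambda>n. 1 ^ (n * (n + 1) div 2) / q_poch q n)) $ n
    = (- 1) ^ n * (1 / q) ^ (n * (n - 1) div 2) * ((- 1) ^ n * q ^ (n * (n - 1) div 2) / q_poch q n)"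
    by (simp add: euler_inv_fps_def)
  also have "\<dots> = ((- 1) ^ n * (- 1) ^ n) * ((1 / q) ^ (n * (n - 1) div 2) * q ^ (n * (n - 1) div 2))
      / q_poch q n"
    by (simp only: times_divide_eq_right mult_ac)
  also have "\<dots> = 1 ^ n / q_poch q n"
    using q_nonzero by (simp add: minus_one_power_square flip: power_mult_distrib)
  finally show "(- 1) ^ n * (1 / q) ^ (n * (n - 1) div 2)
      * inverse (Abs_fps (\<lambda>n. 1 ^ (n * (n + 1) div 2) / q_poch q n)) $ n = 1 ^ n / q_poch q n" .
qed (simp add: subst_qu_1)

text \<open>At \<open>u = q\<close> the series \<^const>\<open>G_ser\<close> becomes \<open>(-qt; q)\<^sub>\<infinity>\<close>, with inverse \<open>1 / (-qt; q)\<^sub>\<infinity>\<close>, and \<open>T\<close> reduces to the sign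
  change \<open>t \<mapsto> -t\<close>.\<close>

lemma a_pol_multiple_u_minus_q:
  assumes "d \<ge> 2"
  shows "a_pol d \<in> multiples_of (u - q)"
proof (rule a_pol_in_multiples[OF assms q_in_upoly])
  fix n :: nat
  define s where "s = fps_const (- q) * fps_X"
  have "Abs_fps (\<lambda>n. q ^ (n * (n + 1) div 2) / q_poch q n) = euler_inv_fps q oo s"
  proof (rule fps_ext)
    fix n
    have "(- q) ^ n * ((- 1) ^ n * q ^ t) = q ^ (t + n)" for t
    proof -
      have "(- q) ^ n * ((- 1) ^ n * q ^ t) = ((- 1) ^ n * (- 1) ^ n) * (q ^ t * q ^ n)"
        unfolding power_minus[of q] by (simp only: mult_ac)
      then show ?thesis by (simp only: minus_one_power_square power_add mult_1_left)
    qed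
    from this[of "n * (n - 1) div 2"]
    show "Abs_fps (\<lambda>n. q ^ (n * (n + 1) div 2) / q_poch q n) $ n = (euler_inv_fps q oo s) $ n"
      unfolding triangle_pred_add s_def fps_nth_compose_linear by (simp add: euler_inv_fps_def)
  qed
  moreover have "(euler_inv_fps q oo s) * (euler_fps q 1 oo s) = 1"
  proof -
    have "(euler_fps q 1 * euler_inv_fps q) oo s = 1 oo s"
      by (simp only: euler_fps_q_inverse)
    then show ?thesis
      by (simp add: s_def fps_compose_mult_distrib mult.commute)
  qed
  then have "inverse (euler_inv_fps q oo s) = euler_fps q 1 oo s"
    by (rule fps_inverse_unique)
  ultimately have "inverse (Abs_fps (\<lambda>n. q ^ (n * (n + 1) div 2) / q_poch q n)) $ n
      = (- q) ^ n / q_poch q n"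
    by (simp add: s_def euler_fps_def)
  moreover have "(- 1) ^ n * (- q) ^ n = q ^ n"
    unfolding power_minus[of q] mult.assoc[symmetric] by (simp only: minus_one_power_square mult_1_left)
  ultimately show "(- 1) ^ n * (q / q) ^ (n * (n - 1) div 2)
      * inverse (Abs_fps (\<lambda>n. q ^ (n * (n + 1) div 2) / q_poch q n)) $ n = q ^ n / q_poch q n"
    using q_nonzero by simp
qed (simp add: subst_qu_q)

section \<open>The leading term\<close>

text \<open>The order of \<open>GL\<^sub>d\<close> over a field with \<open>q\<close> elements.\<close>

definition GL_order :: "nat \<Rightarrow> Qqu"
  where "GL_order d = (\<Prod>i<d. q ^ d - q ^ i)"

lemma GL_order_eq: "GL_order d = (- 1) ^ d * q ^ (d * (d - 1) div 2) * q_poch q d"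
proof (induction d)
  case (Suc d)
  have "GL_order (Suc d) = (q ^ Suc d - 1) * (\<Prod>i<d. q * (q ^ d - q ^ i))"
    unfolding GL_order_def prod.lessThan_Suc_shift by (simp add: algebra_simps)
  also have "\<dots> = (q ^ Suc d - 1) * q ^ d * GL_order d"
    by (simp add: prod.distrib GL_order_def)
  finally show ?case
    unfolding Suc.IH triangle_Suc power_add q_poch_Suc by (simp add: algebra_simps)
qed (simp add: GL_order_def)

lemma GL_order_in_upoly: "GL_order d \<in> upoly 0 0"
  unfolding GL_order_def by (intro upoly_const_prod upoly_diff upoly_const_power q_in_upoly)

lemma GL_order_nonzero: "GL_order d \<noteq> 0"
  using q_nonzero q_poch_q_nonzero by (simp add: GL_order_eq)

text \<open>If the weight \<open>w\<close> is superadditive with this much room, a product of two coefficients of positive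
  index loses at least \<open>n - 1\<close> in \<open>u\<close>-degree. This loss is the precision of the expansion: it
  leaves exactly \<open>d - 1\<close> known top coefficients of \<open>a\<^sub>d\<close>.\<close>

lemma filtration_pair_upoly:
  assumes "\<And>i j. i > 0 \<Longrightarrow> j > 0 \<Longrightarrow> w i + w j + (i + j - 1) \<le> w (i + j)"
  shows "filtration_pair (\<lambda>n. upoly n (w n)) (\<lambda>n. upoly n (w n - (n - 1)))"
  unfolding filtration_pair_def
proof (intro conjI allI ballI impI rat_subspace_upoly)
  show "upoly n (w n - (n - 1)) \<subseteq> upoly n (w n)" for n
    by (auto intro: upoly_mono)
  show "x * y \<in> upoly (i + j) (w (i + j) - (i + j - 1))"
    if ij: "i > 0" "j > 0" and x: "x \<in> upoly i (w i)" and y: "y \<in> upoly j (w j)" for i j x y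
    using upoly_mult[OF x y] assms[OF ij] by (auto elim!: upoly_mono)
qed

lemma add_le_Suc_mult: "i > 0 \<Longrightarrow> j > 0 \<Longrightarrow> i + j - 1 \<le> i * (j::nat)"
  by (cases i; cases j) auto

text \<open>The coefficient \<open>G\<^sub>n\<close> has \<open>u\<close>-degree \<open>n(n+1)/2\<close>, and \<open>1 / G\<close> has the leading term \<open>-G\<^sub>n\<close>. The inverse of \<open>T\<close>
  contributes \<open>u\<close> to the power \<open>n(n-1)/2\<close>, which brings the degree to \<open>n\<^sup>2\<close> and keeps the gap.\<close>

lemma F_ser_nth_approx:
  assumes "n > 0"
  shows "F_ser $ n + u ^ n\<^sup>2 / GL_order n \<in> upoly n (n\<^sup>2 - (n - 1))"
proof -
  define N where "N n = n * (n + 1) div 2" for n :: nat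
  define C where "C n = n * (n - 1) div 2" for n :: nat
  \<comment> \<open>the exponents of \<open>u\<close> in the inverse of \<open>T\<close> and in \<^const>\<open>G_ser\<close> add up to a square\<close>
  have CN: "C n + N n = n\<^sup>2" for n
  proof -
    have "2 * N n = n * (n + 1)" unfolding N_def by (rule triangle_twice)
    moreover have "C n + n = N n" unfolding C_def N_def by (rule triangle_pred_add)
    ultimately show ?thesis by (simp add: power2_eq_square algebra_simps)
  qed
  have "filtration_pair (\<lambda>n. upoly n (N n)) (\<lambda>n. upoly n (N n - (n - 1)))"
  proof (rule filtration_pair_upoly)
    fix i j :: nat assume ij: "i > 0" "j > 0"
    have "2 * N (i + j) = 2 * N i + 2 * N j + 2 * (i * j)"
      unfolding N_def triangle_twice by (simp add: algebra_simps)
    then show "N i + N j + (i + j - 1) \<le> N (i + j)"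
      using add_le_Suc_mult[OF ij] by linarith
  qed
  moreover have "G_ser $ n \<in> upoly n (N n)" if "n > 0" for n
  proof -
    have "n \<le> N n" using triangle_pred_add[of n] unfolding N_def by linarith
    then have "u ^ N n \<in> upoly n (N n)" by (rule upoly_mono[OF u_power_in_upoly]) simp
    then show ?thesis unfolding G_ser_nth N_def[symmetric]
      by (rule upoly_const_divide[OF _ q_poch_in_upoly])
  qed
  ultimately have "inverse G_ser $ n + G_ser $ n \<in> upoly n (N n - (n - 1))"
    by (rule fps_inverse_nth_perturb[OF _ G_ser_0 _ assms])
  moreover have "(- 1) ^ n / q ^ C n \<in> upoly 0 0"
    by (intro upoly_const_divide upoly_const_power upoly_uminus one_in_upoly q_in_upoly)
  ultimately have "(- 1) ^ n / q ^ C n * (u ^ C n * (inverse G_ser $ n + G_ser $ n))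
      \<in> upoly (C n + n) (C n + (N n - (n - 1)))"
    by (intro upoly_const_mult upoly_mult u_power_in_upoly)
  moreover have "(- 1) ^ n / q ^ C n * (u ^ C n * G_ser $ n) = u ^ n\<^sup>2 / GL_order n"
  proof -
    have "(- 1) ^ n * ((- 1) ^ n * x) = (x :: Qqu)" for x
      by (simp flip: mult.assoc power_mult_distrib)
    then show ?thesis
      using q_nonzero q_poch_q_nonzero[of n] unfolding GL_order_eq G_ser_nth C_def[symmetric]
        N_def[symmetric] CN[symmetric] power_add by (simp add: divide_simps)
  qed
  moreover have "(- 1) ^ n / q ^ C n * (u ^ C n * inverse G_ser $ n) = F_ser $ n"
    by (simp add: F_ser_nth C_def power_divide)
  ultimately have "F_ser $ n + u ^ n\<^sup>2 / GL_order n \<in> upoly (C n + n) (C n + (N n - (n - 1)))"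
    by (simp only: distrib_left)
  moreover have "C n + (N n - (n - 1)) \<le> n\<^sup>2 - (n - 1)"
    using CN[of n] triangle_pred_add[of n] unfolding C_def N_def by linarith
  ultimately show ?thesis by (auto elim: upoly_mono)
qed

text \<open>The logarithm changes \<^const>\<open>F_ser\<close> only by products. In the plethystic sum the term of a divisor
  \<open>i > 1\<close> has \<open>u\<close>-degree at most \<open>i (d/i)\<^sup>2\<close>, that is \<open>d\<^sup>2/i\<close>, which does not exceed \<open>d\<^sup>2 - (d-1)\<close>.\<close>

lemma a_pol_approx:
  assumes d: "d \<ge> 2"
  shows "a_pol d * (GL_order d / (q - 1)) - u ^ d\<^sup>2 \<in> upoly d (d\<^sup>2 - (d - 1))"
proof -
  have lead: "u ^ n\<^sup>2 / GL_order n \<in> upoly n (n\<^sup>2)" for n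
    by (rule upoly_const_divide[OF _ GL_order_in_upoly])
       (rule upoly_mono[OF u_power_in_upoly], auto simp: power2_eq_square)
  have fp: "filtration_pair (\<lambda>n. upoly n (n\<^sup>2)) (\<lambda>n. upoly n (n\<^sup>2 - (n - 1)))"
  proof (rule filtration_pair_upoly)
    fix i j :: nat assume "i > 0" "j > 0"
    then show "i\<^sup>2 + j\<^sup>2 + (i + j - 1) \<le> (i + j)\<^sup>2"
      using add_le_Suc_mult[of i j] unfolding power2_sum by linarith
  qed
  note fpD = filtration_pairD[OF fp]
  have FM: "F_ser $ n \<in> upoly n (n\<^sup>2)" if "n > 0" for n
    using upoly_diff[OF fpD(3)[OF F_ser_nth_approx[OF that]] lead[of n]] by simp
  have LF: "fps_log F_ser $ n - F_ser $ n \<in> upoly n (n\<^sup>2 - (n - 1))" if "n > 0" for n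
    by (rule fps_log_nth_perturb[OF fp F_ser_0 FM that])
  have LM: "fps_log F_ser $ n \<in> upoly n (n\<^sup>2)" if "n > 0" for n
    using upoly_add[OF fpD(3)[OF LF[OF that]] FM[OF that]] by simp
  define t where "t i = of_int (moebius_mu i) / of_nat i * subst_qu i (fps_log F_ser $ (d div i))" for i
  define r where "r = (\<Sum>i\<in>{i. i dvd d} - {1}. t i)"
  have "t i \<in> upoly d (d\<^sup>2 - (d - 1))" if "i \<in> {i. i dvd d} - {1}" for i
  proof -
    from that have "i dvd d" by simp
    then obtain m where m: "d = i * m" by (rule dvdE)
    have im: "i > 0" "m > 0" using d unfolding m by (auto intro!: gr0I)
    have "2 \<le> i" using im(1) that by auto
    then have md: "m \<le> d - 1" using mult_le_mono1[of 2 i m] im unfolding m by linarith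
    have "subst_qu i (fps_log F_ser $ m) \<in> upoly (i * m) (i * m\<^sup>2)"
      by (rule subst_qu_upoly[OF im(1) LM[OF im(2)]])
    moreover have "of_int (moebius_mu i) / of_nat i \<in> upoly 0 0"
      by (intro upoly_const_divide of_int_in_upoly of_nat_in_upoly)
    ultimately have "t i \<in> upoly (i * m) (i * m\<^sup>2)"
      unfolding t_def using im m by (intro upoly_const_mult) simp_all
    moreover have "i * m\<^sup>2 \<le> d\<^sup>2 - (d - 1)"
    proof -
      have "i * m\<^sup>2 = d * m" by (simp add: m power2_eq_square)
      also have "\<dots> \<le> d * (d - 1)" using md by (rule mult_le_mono2)
      also have "\<dots> \<le> d\<^sup>2 - (d - 1)" by (simp add: power2_eq_square diff_mult_distrib2)
      finally show ?thesis .
    qed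
    ultimately show ?thesis using m by (auto elim: upoly_mono)
  qed
  then have r: "r \<in> upoly d (d\<^sup>2 - (d - 1))" unfolding r_def by (rule upoly_sum)
  have t1: "t 1 = fps_log F_ser $ d" by (simp add: t_def moebius_mu_def subst_qu_Suc_0)
  have "pleth_Log F_ser $ d = (\<Sum>i | i dvd d. t i)"
    unfolding t_def using d by (intro pleth_Log_nth) auto
  also have "\<dots> = t 1 + r"
    unfolding r_def using d by (intro sum.remove) auto
  finally have "pleth_Log F_ser $ d + u ^ d\<^sup>2 / GL_order d
      = r + (fps_log F_ser $ d - F_ser $ d) + (F_ser $ d + u ^ d\<^sup>2 / GL_order d)"
    using t1 by simp
  moreover have "r + (fps_log F_ser $ d - F_ser $ d) + (F_ser $ d + u ^ d\<^sup>2 / GL_order d)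
      \<in> upoly d (d\<^sup>2 - (d - 1))"
    using d by (intro upoly_add r LF F_ser_nth_approx) auto
  ultimately have "pleth_Log F_ser $ d + u ^ d\<^sup>2 / GL_order d \<in> upoly d (d\<^sup>2 - (d - 1))"
    by (simp only:)
  then have "- GL_order d * (pleth_Log F_ser $ d + u ^ d\<^sup>2 / GL_order d) \<in> upoly d (d\<^sup>2 - (d - 1))"
    by (intro upoly_const_mult upoly_uminus GL_order_in_upoly)
  moreover have "q - 1 \<noteq> 0" using q_power_neq_1[of 1] by simp
  then have "- GL_order d * (pleth_Log F_ser $ d + u ^ d\<^sup>2 / GL_order d)
      = a_pol d * (GL_order d / (q - 1)) - u ^ d\<^sup>2"
    using GL_order_nonzero[of d] by (simp add: a_pol_eq field_simps)
  ultimately show ?thesis by simp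
qed

section \<open>The quotient and its top coefficients\<close>

lemma qint_recurrence: "qint (Suc (Suc n)) = (1 + q_base) * qint (Suc n) - q_base * qint n"
proof -
  have "(1 + q_base) * (q_base ^ Suc n - 1) - q_base * (q_base ^ n - 1) = q_base ^ Suc (Suc n) - 1"
    by (simp add: algebra_simps)
  then show ?thesis
    unfolding qint_def times_divide_eq_right diff_divide_distrib[symmetric] by simp
qed

lemma qint_0_1: "qint 0 = 0" "qint (Suc 0) = 1"
proof -
  have "q_base - 1 \<noteq> 0"
    using q_power_neq_1[of 1] by (auto simp: q_def one_pCons simp flip: of_upoly_1)
  then show "qint 0 = 0" "qint (Suc 0) = 1" by (simp_all add: qint_def)
qed

text \<open>With \<open>x = 1/u\<close> this is \<open>1 / ((1 - x) (1 - qx)) = \<Sum>r. [r+1]\<^sub>q x\<^sup>r\<close>, cut off after \<open>r = e\<close>: multiplying back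
  leaves an error in the two lowest degrees only.\<close>

lemma truncated_geometric_product:
  "[:-1, 1:] * [:-q_base, 1:] * (\<Sum>r=0..e. monom (qint (r + 1)) (e - r))
    = monom 1 (e + 2) - monom (qint (e + 2)) 1 + [:q_base * qint (e + 1):]"
proof (induction e)
  case 0
  show ?case by (simp add: qint_0_1 qint_recurrence monom_altdef eval_nat_numeral)
next
  case (Suc e)
  define S where "S e = (\<Sum>r=0..e. monom (qint (r + 1)) (e - r))" for e
  define Q where "Q = [:-1, 1:] * [:-q_base, 1:]"
  have S: "S (Suc e) = [:0, 1:] * S e + [:qint (e + 2):]"
  proof -
    have "(\<Sum>r=0..e. monom (qint (r + 1)) (Suc e - r)) = [:0, 1:] * S e"
      unfolding S_def sum_distrib_left
      by (intro sum.cong) (auto simp: Suc_diff_le monom_Suc)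
    then show ?thesis by (simp add: S_def monom_0)
  qed
  have "Q * S (Suc e) = [:0, 1:] * (Q * S e) + Q * [:qint (e + 2):]"
    unfolding S by (simp only: algebra_simps)
  also have "Q * S e = monom 1 (e + 2) - monom (qint (e + 2)) 1 + [:q_base * qint (e + 1):]"
    using Suc.IH by (simp add: Q_def S_def)
  also have "[:0, 1:] * (monom 1 (e + 2) - monom (qint (e + 2)) 1 + [:q_base * qint (e + 1):])
      + Q * [:qint (e + 2):]
    = monom 1 (Suc e + 2) - monom (qint (Suc e + 2)) 1 + [:q_base * qint (Suc e + 1):]"
    by (simp add: Q_def monom_Suc monom_0 qint_recurrence[of "Suc e"] algebra_simps)
  finally show ?case by (simp add: Q_def S_def)
qed

lemma factor_out_roots:
  fixes p :: "'a::field poly"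
  assumes X: "\<forall>k<d. coeff p k = 0" and ab: "poly p a = 0" "poly p b = 0"
    and nz: "a \<noteq> 0" "b \<noteq> 0" "a \<noteq> b"
  shows "\<exists>s. p = monom 1 d * ([:-a, 1:] * [:-b, 1:]) * s"
proof -
  have "monom 1 d dvd p" using X by (simp add: monom_1_dvd_iff')
  then obtain p1 where p1: "p = monom 1 d * p1" by (elim dvdE)
  then have "poly p1 a = 0" using ab(1) nz(1) by (simp add: poly_monom)
  then obtain p2 where p2: "p1 = [:-a, 1:] * p2" unfolding poly_eq_0_iff_dvd by (elim dvdE)
  then have "poly p2 b = 0" using ab(2) nz p1 by (simp add: poly_monom)
  then obtain s where s: "p2 = [:-b, 1:] * s" unfolding poly_eq_0_iff_dvd by (elim dvdE)
  have "p = monom 1 d * ([:-a, 1:] * [:-b, 1:]) * s"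
    unfolding p1 p2 s by (simp only: mult.assoc)
  then show ?thesis ..
qed

theorem theorem4p7:
  shows "a_pol 1 = u \<and>
    (\<forall>d\<ge>2. \<exists>abar lower :: Qq poly.
       a_pol d = (q - 1) * u ^ d * (u - 1) * (u - q) / (\<Prod>i<d. q ^ d - q ^ i) * of_upoly abar \<and>
       abar = (\<Sum>r=0..d-2. monom (qint (r + 1)) (d\<^sup>2 - d - 2 - r)) + lower \<and>
       (\<forall>n. coeff lower n \<noteq> 0 \<longrightarrow> n < d\<^sup>2 - 2 * d))"
proof (intro conjI allI impI)
  show "a_pol 1 = u" by (rule a_pol_1)
next
  fix d :: nat assume d: "d \<ge> 2"
  define x where "x = a_pol d * (GL_order d / (q - 1))"
  \<comment> \<open>the degree below which \<open>abar\<close> is not determined\<close>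
  define e where "e = d\<^sup>2 - 2 * d"
  have de: "d\<^sup>2 = e + 2 * d"
    using d mult_le_mono1[of 2 d d] by (simp add: e_def power2_eq_square)
  have q1: "q - 1 \<noteq> 0" using q_power_neq_1[of 1] by simp
  have q_base_1: "q_base \<noteq> 1" using q1 by (auto simp: q_def one_pCons simp flip: of_upoly_1)
  have scalar: "GL_order d / (q - 1) \<in> upoly 0 0"
    by (intro upoly_const_divide GL_order_in_upoly upoly_diff q_in_upoly one_in_upoly)

  obtain w where w: "x - u ^ d\<^sup>2 = of_upoly w"
      "\<forall>k. coeff w k \<noteq> 0 \<longrightarrow> d \<le> k \<and> k \<le> d\<^sup>2 - (d - 1)"
    using a_pol_approx[OF d] unfolding x_def by (rule upolyE)
  define p where "p = monom 1 (d\<^sup>2) + w"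
  have "of_upoly (monom 1 (d\<^sup>2)) = u ^ d\<^sup>2"
    by (simp add: u_def of_upoly_power monom_altdef)
  then have x: "x = of_upoly p" using w(1) by (simp add: p_def of_upoly_add algebra_simps)
  have low: "\<forall>k<d. coeff p k = 0"
  proof (intro allI impI)
    fix k assume "k < d"
    moreover have "d \<le> d\<^sup>2" by (simp add: power2_eq_square)
    ultimately show "coeff p k = 0" using w(2) by (auto simp: p_def)
  qed
  have x_mult: "x \<in> multiples_of (u - c)" if "a_pol d \<in> multiples_of (u - c)" "c \<in> upoly 0 0" for c
  proof -
    have "u - c \<in> range of_upoly"
      using upoly_imp_range[OF that(2)] by (auto simp: u_def simp flip: of_upoly_diff)
    from subring_idealD(7)[OF subring_ideal_multiples[OF this] that(1) upoly_imp_range[OF scalar]]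
    show ?thesis unfolding x_def .
  qed
  have "poly p 1 = 0"
    using x_mult[OF a_pol_multiple_u_minus_1[OF d] one_in_upoly] multiples_of_imp_root[of p 1]
    by (simp add: x one_pCons[symmetric])
  moreover have "poly p q_base = 0"
    using x_mult[OF a_pol_multiple_u_minus_q[OF d] q_in_upoly] multiples_of_imp_root[of p q_base]
    by (simp add: x q_def)
  ultimately obtain s where s: "p = monom 1 d * ([:-1, 1:] * [:-q_base, 1:]) * s"
    using factor_out_roots[OF low, of 1 q_base] q_base_nonzero q_base_1 by auto
  define A where "A = (\<Sum>r=0..d-2. monom (qint (r + 1)) (d\<^sup>2 - d - 2 - r))"
  define D where "D = monom 1 d * ([:-1, 1:] * [:-q_base, 1:])"
  have "A = monom 1 e * (\<Sum>r=0..d-2. monom (qint (r + 1)) (d - 2 - r))"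
    unfolding A_def sum_distrib_left
  proof (rule sum.cong[OF refl])
    fix r assume "r \<in> {0..d - 2}"
    then have "d\<^sup>2 - d - 2 - r = e + (d - 2 - r)" using d de by simp
    then show "monom (qint (r + 1)) (d\<^sup>2 - d - 2 - r) = monom 1 e * monom (qint (r + 1)) (d - 2 - r)"
      by (simp add: mult_monom)
  qed
  then have "D * A = monom 1 d * monom 1 e *
      ([:-1, 1:] * [:-q_base, 1:] * (\<Sum>r=0..d-2. monom (qint (r + 1)) (d - 2 - r)))"
    unfolding D_def by (simp only: mult_ac)
  also have "\<dots> = monom 1 (d + e) * (monom 1 d - monom (qint d) 1 + monom (q_base * qint (d - 1)) 0)"
    unfolding truncated_geometric_product using d
    by (simp add: mult_monom monom_0 numeral_2_eq_2 Suc_diff_Suc)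
  also have "\<dots> = monom 1 (d\<^sup>2) - monom (qint d) (d + e + 1) + monom (q_base * qint (d - 1)) (d + e)"
  proof -
    have "d\<^sup>2 = d + e + d" using de by simp
    then show ?thesis by (simp add: mult_monom distrib_left right_diff_distrib)
  qed
  finally have DA: "D * A = \<dots>" .
  \<comment> \<open>Both \<open>D * s\<close> and \<open>D * A\<close> agree with \<open>u\<close> to the power \<open>d\<^sup>2\<close> above degree \<open>d + e + 1\<close>, and \<open>D\<close> has
    degree \<open>d + 2\<close>, so that \<open>s\<close> and \<open>A\<close> agree in degrees at least \<open>e\<close>.\<close>
  define lower where "lower = s - A"
  have "D * lower = w + monom (qint d) (d + e + 1) - monom (q_base * qint (d - 1)) (d + e)"
    using s DA unfolding lower_def D_def[symmetric] right_diff_distrib by (simp add: p_def)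
  moreover have "degree w \<le> d + e + 1"
  proof (intro degree_le allI impI)
    fix k assume "k > d + e + 1"
    moreover have "d\<^sup>2 - (d - 1) = d + e + 1" using de d by simp
    ultimately show "coeff w k = 0" using w(2) by force
  qed
  ultimately have deg: "degree (D * lower) \<le> d + e + 1"
    by (auto intro!: degree_add_le degree_diff_le order.trans[OF degree_monom_le])
  have "coeff lower n \<noteq> 0 \<longrightarrow> n < e" for n
  proof
    assume n: "coeff lower n \<noteq> 0"
    then have "lower \<noteq> 0" by auto
    moreover have nz: "monom (1 :: Qq) d \<noteq> 0" "[:-1, 1 :: Qq:] \<noteq> 0" "[:-q_base, 1:] \<noteq> 0"
      by (simp_all add: monom_eq_0_iff)
    then have "D \<noteq> 0" unfolding D_def by (simp only: mult_eq_0_iff) simp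
    moreover have "degree D = d + 2"
      unfolding D_def using nz by (subst degree_mult_eq, simp, simp only: mult_eq_0_iff, simp)
        (subst degree_mult_eq, simp_all add: degree_monom_eq)
    ultimately have "degree (D * lower) = d + 2 + degree lower"
      by (simp add: degree_mult_eq)
    then show "n < e" using deg le_degree[OF n] by linarith
  qed
  moreover have "a_pol d = (q - 1) * u ^ d * (u - 1) * (u - q) / (\<Prod>i<d. q ^ d - q ^ i) * of_upoly s"
  proof -
    have "of_upoly [:-1, 1:] = of_upoly ([:0, 1:] - 1)" by (simp add: one_pCons)
    then have u1: "of_upoly [:-1, 1:] = u - 1" by (simp only: u_def of_upoly_diff of_upoly_1)
    have "of_upoly [:-q_base, 1:] = of_upoly ([:0, 1:] - [:q_base:])" by simp
    then have uq: "of_upoly [:-q_base, 1:] = u - q" by (simp only: u_def q_def of_upoly_diff)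
    have ud: "of_upoly (monom 1 d) = u ^ d" by (simp add: u_def of_upoly_power monom_altdef)
    have "of_upoly p = u ^ d * ((u - 1) * (u - q)) * of_upoly s"
      unfolding s by (simp only: of_upoly_mult u1 uq ud)
    moreover have "a_pol d = (q - 1) / GL_order d * of_upoly p"
      unfolding x[symmetric] x_def using q1 GL_order_nonzero[of d] by simp
    ultimately show ?thesis by (simp add: GL_order_def)
  qed
  moreover have "s = A + lower" by (simp add: lower_def)
  ultimately show "\<exists>abar lower :: Qq poly.
       a_pol d = (q - 1) * u ^ d * (u - 1) * (u - q) / (\<Prod>i<d. q ^ d - q ^ i) * of_upoly abar \<and>
       abar = (\<Sum>r=0..d-2. monom (qint (r + 1)) (d\<^sup>2 - d - 2 - r)) + lower \<and>
       (\<forall>n. coeff lower n \<noteq> 0 \<longrightarrow> n < d\<^sup>2 - 2 * d)"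
    unfolding A_def e_def by blast
qed

end
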